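(* Consider the Mackey-Glass model of respiratory dynamics $$\dot{x}(t)=r(t)\left[\alpha-\frac{\beta x(t)x^n(h(t))}{1+x^n(h(t))}\right],\quad t\geq 0,$$ with initial condition $x(t)=\varphi(t)$, $t\leq 0$, where $\alpha,\beta,n>0$ are constants, $r$ is a Lebesgue measurable function, and $h(t)\leq t$ is a Lebesgue measurable delay function. Let $K$ be the unique positive solution of $\beta K^{n+1}=\alpha(1+K^n)$, and put $$\mu=\frac{\alpha}{\beta},\quad M=\frac{\alpha}{\beta}\left[1+\left(\frac{\beta}{\alpha}\right)^n\right],\quad c=\ln\frac{\mu}{K},\quad C=\ln\frac{M}{K}.$$ Suppose $t-h(t)\leq h_0$ and $0<r_0\leq r(t)<R$ for all $t\ge 0$, for some constants $h_0,r_0,R$, and that the inequality $$\frac{a_0}{b_0}e^{-Ah_0}>\ln\frac{b_0^2+a_0b_0}{b_0^2+a_0^2}$$ holds, where $$a_0=\frac{\alpha}{K}\,\frac{1-e^{-C}}{C}\,r_0,\qquad A=\frac{\alpha}{K}\,\frac{1-e^{-c}}{c}\,R,\qquad b_0=\frac{\beta nR}{4}.$$ Then $K$ is a global attractor for all solutions of the initial value problem with $\varphi(t)\geq 0$ for $t\le 0$ and $\varphi(0)>0$, i.e. every such solution satisfies $\lim_{t\to\infty}x(t)=K$.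
   Context: The initial function $\varphi:(-\infty,0]\to\mathbb{R}$ is Borel measurable and bounded. A solution of the initial value problem is a function $x$ that is absolutely continuous on $[0,\infty)$ (i.e. on its bounded subintervals), satisfies the differential equation for almost every $t\geq 0$, and satisfies $x(t)=\varphi(t)$ for $t\leq 0$. The notation $x^n(h(t))$ means $(x(h(t)))^n$. *)

theory Defs
  imports "HOL-Analysis.Analysis"
begin

text \<open>The library constant \<^const>\<open>absolutely_continuous\<close> concerns measures; this is the notion for
  real functions. Only finite families occur, indexed by finite sets of natural numbers, and
  the open intervals \<open>{u i<..<v i}\<close> are required to be disjoint, so that the closed ones may
  share endpoints.\<close>

definition absolutely_continuous_fun_on :: "real set \<Rightarrow> (real \<Rightarrow> real) \<Rightarrow> bool" where
  "absolutely_continuous_fun_on S f \<longleftrightarrow>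
     (\<forall>\<epsilon>>0. \<exists>\<delta>>0. \<forall>(I :: nat set) u v.
        finite I \<and> (\<forall>i\<in>I. u i \<le> v i \<and> {u i..v i} \<subseteq> S) \<and>
        disjoint_family_on (\<lambda>i. {u i<..<v i}) I \<and>
        (\<Sum>i\<in>I. v i - u i) < \<delta>
        \<longrightarrow> (\<Sum>i\<in>I. \<bar>f (v i) - f (u i)\<bar>) < \<epsilon>)"

definition admissible_initial_function :: "(real \<Rightarrow> real) \<Rightarrow> bool" where
  "admissible_initial_function \<phi> \<longleftrightarrow>
     \<phi> \<in> borel_measurable (restrict_space borel {..0}) \<and> bounded (\<phi> ` {..0})"

text \<open>Powers are \<open>powr\<close> because the exponent \<open>n\<close> is an arbitrary positive real. If \<open>n > 0\<close>, then
  \<open>0 powr n = 0\<close>, as it should be for vanishing initial data; on negative reals \<open>powr\<close> is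
  totalised by a convention, but solutions with \<open>\<phi> \<ge> 0\<close> and \<open>\<phi> 0 > 0\<close> never become negative.\<close>

definition mackey_glass_solution ::
  "(real \<Rightarrow> real) \<Rightarrow> (real \<Rightarrow> real) \<Rightarrow> real \<Rightarrow> real \<Rightarrow> real \<Rightarrow> (real \<Rightarrow> real) \<Rightarrow> (real \<Rightarrow> real) \<Rightarrow> bool"
  where
  "mackey_glass_solution r h \<alpha> \<beta> n \<phi> x \<longleftrightarrow>
     (\<forall>T\<ge>0. absolutely_continuous_fun_on {0..T} x) \<and>
     (AE t in lebesgue. t \<ge> 0 \<longrightarrow>
        (x has_real_derivative
           r t * (\<alpha> - \<beta> * x t * x (h t) powr n / (1 + x (h t) powr n))) (at t)) \<and>
     (\<forall>t\<le>0. x t = \<phi> t)"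

definition mackey_glass_equilibrium :: "real \<Rightarrow> real \<Rightarrow> real \<Rightarrow> real" where
  "mackey_glass_equilibrium \<alpha> \<beta> n =
     (THE K. K > 0 \<and> \<beta> * K powr (n + 1) = \<alpha> * (1 + K powr n))"

lemma mackey_glass_equilibrium_ex1:
  fixes \<alpha> \<beta> n :: real
  assumes "\<alpha> > 0" "\<beta> > 0" "n > 0"
  shows "\<exists>!K. K > 0 \<and> \<beta> * K powr (n + 1) = \<alpha> * (1 + K powr n)"
proof -
  define g where "g = (\<lambda>K::real. \<beta> * K - \<alpha> * (1 + K powr (-n)))"
  have eq: "\<beta> * K powr (n + 1) = \<alpha> * (1 + K powr n) \<longleftrightarrow> g K = 0" if "K > 0" for K
  proof -
    have "K powr n > 0" "K powr (n + 1) = K powr n * K" using that by (auto simp: powr_add)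
    thus ?thesis
      unfolding g_def by (simp add: powr_minus field_simps)
  qed
  have mono: "g K < g L" if "0 < K" "K < L" for K L
  proof -
    have "L powr (-n) < K powr (-n)"
      using that assms by (intro powr_less_mono2_neg) auto
    thus ?thesis
      unfolding g_def using that assms
      by (smt (verit) mult_less_cancel_left_pos)
  qed
  define \<mu> where "\<mu> = \<alpha> / \<beta>"
  define M where "M = \<mu> * (1 + \<mu> powr (-n))"
  have \<mu>: "\<mu> > 0" "\<beta> * \<mu> = \<alpha>" using assms by (auto simp: \<mu>_def)
  have "\<mu> * 1 \<le> \<mu> * (1 + \<mu> powr (-n))"
    using \<mu> by (intro mult_left_mono) auto
  hence le: "\<mu> \<le> M" by (simp add: M_def)
  have "g \<mu> \<le> 0" using \<mu> assms by (simp add: g_def algebra_simps)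
  moreover have "g M \<ge> 0"
  proof -
    have "M powr (-n) \<le> \<mu> powr (-n)"
      using le \<mu> assms by (intro powr_mono2') auto
    moreover have "\<beta> * M = \<alpha> * (1 + \<mu> powr (-n))"
      using \<mu> by (simp add: M_def)
    ultimately show ?thesis
      unfolding g_def using assms by simp
  qed
  moreover have "continuous_on {\<mu>..M} g"
    unfolding g_def using \<mu> by (intro continuous_intros) auto
  ultimately obtain K where K: "\<mu> \<le> K" "g K = 0"
    using IVT'[of g \<mu> 0 M] le by auto
  show ?thesis
  proof (rule ex1I[of _ K])
    show "K > 0 \<and> \<beta> * K powr (n + 1) = \<alpha> * (1 + K powr n)"
      using K \<mu> eq[of K] by auto
    show "L = K" if "L > 0 \<and> \<beta> * L powr (n + 1) = \<alpha> * (1 + L powr n)" for L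
      using that K \<mu> eq[of L] mono[of L K] mono[of K L] by linarith
  qed
qed

end

theory Submission
  imports Defs
begin

text \<open>Every solution stays positive and eventually enters the interval from \<open>\<mu>\<close> to \<open>M\<close>. Then
  \<open>y = ln (x / K)\<close> satisfies a linear equation \<open>y' = - a (y + \<kappa> y(h))\<close> with \<open>a\<^sub>0 \<le> a \<le> A\<close> and
  \<open>0 \<le> \<kappa> \<le> k = b\<^sub>0 / a\<^sub>0\<close>. In the time \<open>\<sigma> = \<integral> a\<close> the decay rate is one and the delay at most
  \<open>\<tau> = A h\<^sub>0\<close>. If \<open>y \<ge> - Q\<close> from some time on, then comparing \<open>y\<close> after its last zero with the
  worst feedback compatible with this bound shows that \<open>y\<close> is asymptotically at most \<open>\<theta> Q\<close>, where
  \<open>\<theta> = k ((1 + k) exp (- exp (- \<tau>) / k) - k)\<close>. The hypothesis says \<open>\<theta> < 1\<close>; as the linear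
  equation is invariant under \<open>y \<mapsto> - y\<close>, the bounds on \<open>\<bar>y\<bar>\<close> contract to \<open>0\<close>.\<close>

subsection \<open>Absolutely continuous functions\<close>

text \<open>Passing to \<open>ln (x / K)\<close> is exact, not a linearisation. With
  \<open>\<beta> * hill n K = \<alpha> / K\<close> the right-hand side splits into an instantaneous
  and a delayed difference, each of which vanishes at equilibrium and is a quotient times
  \<open>y\<close> or \<open>y (h t)\<close>. The first quotient,
  \<open>(1 - exp (- y)) / y\<close>, decreases in \<open>y\<close>; its values at the eventual
  bounds \<open>C\<close> and \<open>c\<close> of \<open>y\<close> give \<open>a\<^sub>0\<close> and
  \<open>A\<close>. The second is a slope of a logistic curve, at most \<open>n / 4\<close>, hence
  \<open>b\<^sub>0\<close>. Both depend on the solution but are then treated as given functions of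
  time. This makes the change of sign of \<open>y\<close> admissible although the original equation
  has no such symmetry. The constant of the contraction is the exact maximum of the comparison
  function that results from the worst feedback, not an estimate of it. Derivatives exist only
  almost everywhere. Every comparison is therefore a monotonicity statement about an absolutely
  continuous function with an integrating factor, and time is never reparametrised.\<close>

lemma absolutely_continuous_fun_on_subset:
  assumes "absolutely_continuous_fun_on S f" "T \<subseteq> S"
  shows "absolutely_continuous_fun_on T f"
  using assms unfolding absolutely_continuous_fun_on_def by (meson subset_trans)

lemma absolutely_continuous_fun_onE:
  assumes "absolutely_continuous_fun_on S f" "e > 0"
  obtains d where "d > 0" and "\<forall>(I :: nat set) u v.
        finite I \<and> (\<forall>i\<in>I. u i \<le> v i \<and> {u i..v i} \<subseteq> S) \<and>
        disjoint_family_on (\<lambda>i. {u i<..<v i}) I \<and> (\<Sum>i\<in>I. v i - u i) < d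
        \<longrightarrow> (\<Sum>i\<in>I. \<bar>f (v i) - f (u i)\<bar>) < e"
  using assms(1)[unfolded absolutely_continuous_fun_on_def, THEN spec, THEN mp, OF assms(2)]
  by (elim exE conjE) (rule that)

lemma absolutely_continuous_fun_on_imp_continuous_on:
  assumes "absolutely_continuous_fun_on {a..b} f"
  shows "continuous_on {a..b} f"
  unfolding continuous_on_iff
proof (intro ballI allI impI)
  fix s and e :: real assume s: "s \<in> {a..b}" and "e > 0"
  obtain d where "d > 0" and d: "\<forall>(I :: nat set) u v.
        finite I \<and> (\<forall>i\<in>I. u i \<le> v i \<and> {u i..v i} \<subseteq> {a..b}) \<and>
        disjoint_family_on (\<lambda>i. {u i<..<v i}) I \<and> (\<Sum>i\<in>I. v i - u i) < d
        \<longrightarrow> (\<Sum>i\<in>I. \<bar>f (v i) - f (u i)\<bar>) < e"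
    by (rule absolutely_continuous_fun_onE[OF assms \<open>e > 0\<close>]) (rule that)
  have *: "\<bar>f v - f u\<bar> < e" if "u \<in> {a..b}" "v \<in> {a..b}" "u \<le> v" "v - u < d" for u v
    using d[rule_format, of "{0}" "\<lambda>_. u" "\<lambda>_. v"] that by (auto simp: disjoint_family_on_def)
  show "\<exists>d>0. \<forall>t\<in>{a..b}. dist t s < d \<longrightarrow> dist (f t) (f s) < e"
  proof (intro exI conjI ballI impI)
    fix t assume "t \<in> {a..b}" "dist t s < d"
    thus "dist (f t) (f s) < e"
      using *[of t s] *[of s t] s by (auto simp: dist_real_def abs_if split: if_splits)
  qed fact
qed

text \<open>Sums of increments inherit the bound term by term. The closure properties below
  (differences, products, Lipschitz functions, compositions) then only have to supply a constant
  \<open>L\<close>.\<close>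

lemma absolutely_continuous_fun_on_dominated:
  fixes F f g :: "real \<Rightarrow> real"
  assumes f: "absolutely_continuous_fun_on S f" and g: "absolutely_continuous_fun_on S g"
    and dom: "\<And>u v. u \<in> S \<Longrightarrow> v \<in> S \<Longrightarrow> \<bar>F v - F u\<bar> \<le> L * (\<bar>f v - f u\<bar> + \<bar>g v - g u\<bar>)"
  shows "absolutely_continuous_fun_on S F"
  unfolding absolutely_continuous_fun_on_def
proof (intro allI impI)
  fix e :: real assume "e > 0"
  define L' where "L' = \<bar>L\<bar> + 1"
  have L': "L' > 0" "L \<le> L'" by (auto simp: L'_def)
  define e' where "e' = e / (2 * L')"
  have e': "e' > 0" "2 * L' * e' = e" using \<open>e > 0\<close> L' by (auto simp: e'_def)
  obtain d1 where "d1 > 0" and d1: "\<forall>(I :: nat set) u v.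
        finite I \<and> (\<forall>i\<in>I. u i \<le> v i \<and> {u i..v i} \<subseteq> S) \<and>
        disjoint_family_on (\<lambda>i. {u i<..<v i}) I \<and> (\<Sum>i\<in>I. v i - u i) < d1
        \<longrightarrow> (\<Sum>i\<in>I. \<bar>f (v i) - f (u i)\<bar>) < e'"
    by (rule absolutely_continuous_fun_onE[OF f e'(1)]) (rule that)
  obtain d2 where "d2 > 0" and d2: "\<forall>(I :: nat set) u v.
        finite I \<and> (\<forall>i\<in>I. u i \<le> v i \<and> {u i..v i} \<subseteq> S) \<and>
        disjoint_family_on (\<lambda>i. {u i<..<v i}) I \<and> (\<Sum>i\<in>I. v i - u i) < d2
        \<longrightarrow> (\<Sum>i\<in>I. \<bar>g (v i) - g (u i)\<bar>) < e'"
    by (rule absolutely_continuous_fun_onE[OF g e'(1)]) (rule that)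
  show "\<exists>d>0. \<forall>(I :: nat set) u v.
        finite I \<and> (\<forall>i\<in>I. u i \<le> v i \<and> {u i..v i} \<subseteq> S) \<and>
        disjoint_family_on (\<lambda>i. {u i<..<v i}) I \<and> (\<Sum>i\<in>I. v i - u i) < d
        \<longrightarrow> (\<Sum>i\<in>I. \<bar>F (v i) - F (u i)\<bar>) < e"
  proof (intro exI[of _ "min d1 d2"] conjI allI impI)
    fix I :: "nat set" and u v
    assume *: "finite I \<and> (\<forall>i\<in>I. u i \<le> v i \<and> {u i..v i} \<subseteq> S) \<and>
        disjoint_family_on (\<lambda>i. {u i<..<v i}) I \<and> (\<Sum>i\<in>I. v i - u i) < min d1 d2"
    have "\<bar>F (v i) - F (u i)\<bar> \<le> L' * (\<bar>f (v i) - f (u i)\<bar> + \<bar>g (v i) - g (u i)\<bar>)" if "i \<in> I" for i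
    proof -
      have "u i \<le> v i" "{u i..v i} \<subseteq> S" using * that by auto
      hence "u i \<in> S" "v i \<in> S" by auto
      hence "\<bar>F (v i) - F (u i)\<bar> \<le> L * (\<bar>f (v i) - f (u i)\<bar> + \<bar>g (v i) - g (u i)\<bar>)"
        using dom by blast
      also have "\<dots> \<le> L' * (\<bar>f (v i) - f (u i)\<bar> + \<bar>g (v i) - g (u i)\<bar>)"
        using L' by (intro mult_right_mono) auto
      finally show ?thesis .
    qed
    hence "(\<Sum>i\<in>I. \<bar>F (v i) - F (u i)\<bar>)
        \<le> (\<Sum>i\<in>I. L' * (\<bar>f (v i) - f (u i)\<bar> + \<bar>g (v i) - g (u i)\<bar>))"
      by (intro sum_mono)
    also have "\<dots> = L' * ((\<Sum>i\<in>I. \<bar>f (v i) - f (u i)\<bar>) + (\<Sum>i\<in>I. \<bar>g (v i) - g (u i)\<bar>))"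
      by (simp only: sum_distrib_left[symmetric] sum.distrib)
    also have "\<dots> < L' * (e' + e')"
      using d1[rule_format, of I u v] d2[rule_format, of I u v] * L'
      by (intro mult_strict_left_mono add_strict_mono) argo+
    finally show "(\<Sum>i\<in>I. \<bar>F (v i) - F (u i)\<bar>) < e" using e' by simp
  qed (use \<open>d1 > 0\<close> \<open>d2 > 0\<close> in auto)
qed

lemma absolutely_continuous_fun_on_diff:
  assumes "absolutely_continuous_fun_on S f" "absolutely_continuous_fun_on S g"
  shows "absolutely_continuous_fun_on S (\<lambda>t. f t - g t)"
  by (rule absolutely_continuous_fun_on_dominated[OF assms, where L = 1]) auto

lemma absolutely_continuous_fun_on_mult:
  assumes f: "absolutely_continuous_fun_on {a..b} f" and g: "absolutely_continuous_fun_on {a..b} g"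
  shows "absolutely_continuous_fun_on {a..b} (\<lambda>t. f t * g t)"
proof -
  have "bounded (f ` {a..b})" "bounded (g ` {a..b})"
    using f g by (auto intro!: compact_imp_bounded compact_continuous_image
        absolutely_continuous_fun_on_imp_continuous_on)
  then obtain B1 B2 where B: "\<And>t. t \<in> {a..b} \<Longrightarrow> \<bar>f t\<bar> \<le> B1" "\<And>t. t \<in> {a..b} \<Longrightarrow> \<bar>g t\<bar> \<le> B2"
    by (fastforce simp: bounded_iff)
  show ?thesis
  proof (rule absolutely_continuous_fun_on_dominated[OF f g, where L = "max B1 B2"])
    fix u v assume uv: "u \<in> {a..b}" "v \<in> {a..b}"
    have "f v * g v - f u * g u = g v * (f v - f u) + f u * (g v - g u)"
      by (simp add: algebra_simps)
    hence "\<bar>f v * g v - f u * g u\<bar> \<le> \<bar>g v\<bar> * \<bar>f v - f u\<bar> + \<bar>f u\<bar> * \<bar>g v - g u\<bar>"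
      by (metis abs_mult abs_triangle_ineq)
    also have "\<dots> \<le> max B1 B2 * \<bar>f v - f u\<bar> + max B1 B2 * \<bar>g v - g u\<bar>"
      using B uv by (intro add_mono mult_right_mono) (fastforce simp: le_max_iff_disj)+
    finally show "\<bar>f v * g v - f u * g u\<bar> \<le> max B1 B2 * (\<bar>f v - f u\<bar> + \<bar>g v - g u\<bar>)"
      by (simp add: algebra_simps)
  qed
qed

lemma absolutely_continuous_fun_on_lipschitz:
  assumes "L-lipschitz_on S f"
  shows "absolutely_continuous_fun_on S f"
proof -
  have "absolutely_continuous_fun_on S (\<lambda>t. t)"
    unfolding absolutely_continuous_fun_on_def
  proof (intro allI impI)
    fix e :: real assume "e > 0"
    show "\<exists>d>0. \<forall>(I :: nat set) u v.
        finite I \<and> (\<forall>i\<in>I. u i \<le> v i \<and> {u i..v i} \<subseteq> S) \<and>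
        disjoint_family_on (\<lambda>i. {u i<..<v i}) I \<and> (\<Sum>i\<in>I. v i - u i) < d
        \<longrightarrow> (\<Sum>i\<in>I. \<bar>v i - u i\<bar>) < e"
    proof (intro exI[of _ e] conjI allI impI)
      fix I :: "nat set" and u v
      assume *: "finite I \<and> (\<forall>i\<in>I. u i \<le> v i \<and> {u i..v i} \<subseteq> S) \<and>
        disjoint_family_on (\<lambda>i. {u i<..<v i}) I \<and> (\<Sum>i\<in>I. v i - u i) < e"
      hence "(\<Sum>i\<in>I. \<bar>v i - u i\<bar>) = (\<Sum>i\<in>I. v i - u i)"
        by (intro sum.cong) auto
      thus "(\<Sum>i\<in>I. \<bar>v i - u i\<bar>) < e" using * by argo
    qed fact
  qed
  from this this show ?thesis
  proof (rule absolutely_continuous_fun_on_dominated[where L = L])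
    show "\<bar>f v - f u\<bar> \<le> L * (\<bar>v - u\<bar> + \<bar>v - u\<bar>)" if "u \<in> S" "v \<in> S" for u v
      using lipschitz_onD[OF assms that(2,1)] lipschitz_on_nonneg[OF assms]
      by (simp add: dist_real_def distrib_left)
  qed
qed

text \<open>The image of a segment is compact and convex, so \<open>G'\<close> is bounded on it and
  \<open>G\<close> is Lipschitz there. Asking for \<open>G\<close> on this image only admits the
  logarithm along a positive solution.\<close>

lemma absolutely_continuous_fun_on_compose:
  assumes f: "absolutely_continuous_fun_on {a..b} f"
    and G: "\<And>z. z \<in> f ` {a..b} \<Longrightarrow> (G has_real_derivative G' z) (at z)"
    and G': "continuous_on (f ` {a..b}) G'"
  shows "absolutely_continuous_fun_on {a..b} (\<lambda>t. G (f t))"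
proof -
  note cont = absolutely_continuous_fun_on_imp_continuous_on[OF f]
  have cc: "compact (f ` {a..b})" "convex (f ` {a..b})"
    using compact_continuous_image[OF cont] connected_continuous_image[OF cont]
    by (auto simp flip: connected_convex_1)
  have "bounded (G' ` (f ` {a..b}))"
    using G' cc by (intro compact_imp_bounded compact_continuous_image[of _ G'])
  then obtain B where B: "\<And>z. z \<in> f ` {a..b} \<Longrightarrow> \<bar>G' z\<bar> \<le> B"
    unfolding bounded_iff by auto
  show ?thesis
  proof (rule absolutely_continuous_fun_on_dominated[OF f f, where L = B])
    fix u v assume uv: "u \<in> {a..b}" "v \<in> {a..b}"
    hence B0: "0 \<le> B" using B[of "f u"] by auto
    have "norm (G (f v) - G (f u)) \<le> B * norm (f v - f u)"
      using uv by (intro field_differentiable_bound[OF cc(2) has_field_derivative_at_within[OF G]])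
        (auto intro: B)
    thus "\<bar>G (f v) - G (f u)\<bar> \<le> B * (\<bar>f v - f u\<bar> + \<bar>f v - f u\<bar>)"
      using B0 mult_nonneg_nonneg[OF B0 abs_ge_zero[of "f v - f u"]] by (simp add: distrib_left)
  qed
qed

text \<open>The derivative controls the increments over a fine tagged division whose tags avoid the null
  set; those with tags in the null set lie in an open set of small measure, where absolute
  continuity applies.\<close>

lemma absolutely_continuous_fun_on_nonincreasing:
  assumes ac: "absolutely_continuous_fun_on {a..b} f" and ab: "a \<le> b"
    and deriv: "AE t in lebesgue. a < t \<and> t < b \<longrightarrow> (\<exists>D\<le>0. (f has_real_derivative D) (at t))"
  shows "f b \<le> f a"
proof (rule field_le_epsilon)
  fix e0 :: real assume "e0 > 0"
  \<comment> \<open>The error budget: \<open>e * (b - a)\<close> for tags outside the null set and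
    \<open>e\<close> for tags inside it add up to \<open>e0\<close>.\<close>
  define e where "e = e0 / (b - a + 1)"
  have "e * (b - a + 1) = e0" using ab by (simp add: e_def)
  hence e: "e > 0" "e * (b - a) + e = e0"
    using \<open>e0 > 0\<close> ab by (auto simp: e_def distrib_left)
  obtain N0 where N0: "N0 \<in> null_sets lebesgue"
    "{t. \<not> (a < t \<and> t < b \<longrightarrow> (\<exists>D\<le>0. (f has_real_derivative D) (at t)))} \<subseteq> N0"
    using deriv unfolding eventually_ae_filter by auto
  \<comment> \<open>The derivative is controlled at interior points only, so the endpoints join the
    exceptional set.\<close>
  define N where "N = N0 \<union> {a, b}"
  have N: "N \<in> null_sets lebesgue"
    unfolding N_def using N0(1)
    by (auto intro!: null_sets.Un simp: negligible_iff_null_sets[symmetric])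
  have good: "\<exists>D\<le>0. (f has_real_derivative D) (at t)" if "t \<in> {a..b}" "t \<notin> N" for t
  proof -
    have "a < t" "t < b" "t \<notin> N0" using that by (auto simp: N_def less_le)
    thus ?thesis using N0(2) by blast
  qed
  obtain d where "d > 0" and d: "\<forall>(I :: nat set) u v.
        finite I \<and> (\<forall>i\<in>I. u i \<le> v i \<and> {u i..v i} \<subseteq> {a..b}) \<and>
        disjoint_family_on (\<lambda>i. {u i<..<v i}) I \<and> (\<Sum>i\<in>I. v i - u i) < d
        \<longrightarrow> (\<Sum>i\<in>I. \<bar>f (v i) - f (u i)\<bar>) < e"
    by (rule absolutely_continuous_fun_onE[OF ac e(1)]) (rule that)
  obtain U where U: "open U" "N \<subseteq> U" "(U - N) \<in> lmeasurable" "emeasure lebesgue (U - N) < ennreal d"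
    using sets_lebesgue_outer_open[of N d] N \<open>d > 0\<close> by (auto dest: null_setsD2)
  have "U - N \<in> sets lebesgue" using U by auto
  hence "emeasure lebesgue U = emeasure lebesgue (U - N)"
    using emeasure_Diff_null_set[OF N, of U] U(1) by auto
  hence emU: "emeasure lebesgue U < ennreal d" using U by simp
  hence Um: "U \<in> lmeasurable"
    using U(1) by (auto intro!: fmeasurableI simp: less_top[symmetric] top_unique dest: less_trans)
  have mU: "measure lebesgue U < d"
    using emU Um \<open>d > 0\<close> by (simp add: emeasure_eq_measure2 ennreal_less_iff)
  define P where "P = (\<lambda>t r. r > 0 \<and> (t \<in> N \<longrightarrow> ball t r \<subseteq> U) \<and>
     (t \<in> {a..b} - N \<longrightarrow> (\<forall>u v. u \<le> t \<and> t \<le> v \<and> u \<in> ball t r \<and> v \<in> ball t r \<longrightarrow> f v - f u \<le> e * (v - u))))"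
  have "\<exists>r. P t r" for t
  proof -
    consider "t \<in> N" | "t \<notin> N" "t \<in> {a..b}" | "t \<notin> N" "t \<notin> {a..b}" by blast
    thus ?thesis
    proof cases
      case 1
      then obtain r where "r > 0" "ball t r \<subseteq> U" using U by (metis open_contains_ball subsetD)
      thus ?thesis using 1 by (auto simp: P_def)
    next
      case 2
      then obtain D where D: "D \<le> 0" "(f has_real_derivative D) (at t)" using good by blast
      from D(2) have "(f has_derivative (\<lambda>x. x * D)) (at t)"
        by (simp add: has_field_derivative_def mult.commute[of _ D])
      then obtain r where r: "r > 0" "\<And>s. norm (s - t) < r \<Longrightarrow> norm (f s - f t - (s - t) * D) \<le> e * norm (s - t)"
        using e(1) unfolding has_derivative_at_alt by blast
      \<comment> \<open>Straddle estimate: as \<open>t\<close> lies between \<open>u\<close> and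
        \<open>v\<close>, the two approximation errors add up to \<open>e * (v - u)\<close>, and the
        remaining linear term is discarded by the sign of \<open>D\<close>.\<close>
      have "f v - f u \<le> e * (v - u)" if "u \<le> t" "t \<le> v" "u \<in> ball t r" "v \<in> ball t r" for u v
      proof -
        have "\<bar>f v - f t - (v - t) * D\<bar> \<le> e * (v - t)" "\<bar>f u - f t - (u - t) * D\<bar> \<le> e * (t - u)"
          using r(2)[of v] r(2)[of u] that by (auto simp: dist_real_def)
        hence "f v - f u \<le> e * (v - t) + e * (t - u) + (v - u) * D"
          unfolding abs_le_iff by (simp add: algebra_simps)
        moreover have "(v - u) * D \<le> 0"
          using that D by (intro mult_nonneg_nonpos) auto
        ultimately show ?thesis by (simp add: algebra_simps)
      qed
      thus ?thesis using 2 r(1) by (auto simp: P_def)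
    next
      case 3
      thus ?thesis by (auto simp: P_def intro: exI[of _ 1])
    qed
  qed
  then obtain r where r: "\<And>t. P t (r t)" by metis
  have "gauge (\<lambda>t. ball t (r t))"
    using r by (intro gauge_ball_dependent) (auto simp: P_def)
  then obtain p where p: "p tagged_division_of {a..b}" "(\<lambda>t. ball t (r t)) fine p"
    by (rule fine_division_exists_real)
  note pD = tagged_division_ofD[OF p(1)]
  have box: "\<exists>u v. K = {u..v} \<and> u \<le> x \<and> x \<le> v \<and> Inf K = u \<and> Sup K = v \<and> a \<le> u \<and> v \<le> b \<and>
       u \<in> ball x (r x) \<and> v \<in> ball x (r x)" if xK: "(x, K) \<in> p" for x K
  proof -
    obtain u v where uv: "K = {u..v}" using pD(4)[OF xK] by (auto simp: cbox_interval)
    have "x \<in> K" "K \<subseteq> {a..b}" "K \<subseteq> ball x (r x)"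
      using pD(2,3)[OF xK] fineD[OF p(2) xK] by auto
    moreover from this have "u \<in> K" "v \<in> K" unfolding uv by auto
    moreover have "u \<le> x" "x \<le> v" "a \<le> u" "v \<le> b" "Inf K = u" "Sup K = v"
      using calculation unfolding uv by auto
    ultimately show ?thesis using uv by blast
  qed
  define q where "q = {(x, K) \<in> p. x \<in> N}"
  have "q \<subseteq> p" by (auto simp: q_def)
  hence q: "finite q" "q \<subseteq> p" using pD(1) by (auto intro: finite_subset)
  define F where "F = (\<lambda>(x :: real, K). f (Sup K) - f (Inf K))"
  define l where "l = (\<lambda>(x :: real, K :: real set). Sup K - Inf K)"
  have "f b - f a = sum F p"
    unfolding F_def using additive_tagged_division_1[OF ab p(1), of f] by simp
  also have "\<dots> = sum F (p - q) + sum F q"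
    using q pD(1) by (metis sum.subset_diff)
  also have "sum F (p - q) \<le> (\<Sum>y\<in>p - q. e * l y)"
  proof (rule sum_mono)
    fix y assume y: "y \<in> p - q"
    then obtain x K where xK: "y = (x, K)" "(x, K) \<in> p" "x \<notin> N" by (cases y) (auto simp: q_def)
    from box[OF xK(2)] obtain u v where uv: "K = {u..v}" "u \<le> x" "x \<le> v" "Inf K = u" "Sup K = v"
       "a \<le> u" "v \<le> b" "u \<in> ball x (r x)" "v \<in> ball x (r x)" by blast
    have "f v - f u \<le> e * (v - u)"
      using r[of x] uv xK unfolding P_def by auto
    thus "F y \<le> e * l y" using uv xK by (simp add: F_def l_def)
  qed
  also have "\<dots> \<le> (\<Sum>y\<in>p. e * l y)"
  proof (rule sum_mono2)
    show "finite p" by (rule pD(1))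
    show "0 \<le> e * l y" if y: "y \<in> p - (p - q)" for y
    proof -
      obtain x K where xK: "y = (x, K)" "(x, K) \<in> p" using y by (cases y) auto
      from box[OF xK(2)] show ?thesis using xK e(1) by (auto simp: l_def)
    qed
  qed auto
  also have "\<dots> = e * (b - a)"
    using additive_tagged_division_1[OF ab p(1), of "\<lambda>t. t"] by (simp add: l_def flip: sum_distrib_left)
  also have "sum F q < e"
  proof -
    \<comment> \<open>Absolute continuity is phrased for families indexed by natural numbers, so the
      tagged intervals are enumerated.\<close>
    obtain g where g: "bij_betw g {..<card q} q"
      using ex_bij_betw_nat_finite[OF q(1)] by (auto simp: atLeast0LessThan)
    define u where "u = (\<lambda>i. Inf (snd (g i)))"
    define v where "v = (\<lambda>i. Sup (snd (g i)))"
    have gi: "\<exists>x K. g i = (x, K) \<and> (x, K) \<in> p \<and> x \<in> N \<and> K = {u i..v i} \<and> u i \<le> v i \<and> {u i..v i} \<subseteq> {a..b} \<and> {u i..v i} \<subseteq> U"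
      if i: "i < card q" for i
    proof -
      have "g i \<in> q" using g i by (auto simp: bij_betw_def)
      then obtain x K where xK: "g i = (x, K)" "(x, K) \<in> p" "x \<in> N" by (cases "g i") (auto simp: q_def)
      have "K \<subseteq> U" using fineD[OF p(2) xK(2)] r[of x] xK(3) unfolding P_def by auto
      with box[OF xK(2)] xK show ?thesis by (fastforce simp: u_def v_def)
    qed
    have disj: "disjoint_family_on (\<lambda>i. {u i<..<v i}) {..<card q}"
      unfolding disjoint_family_on_def
    proof (intro ballI impI)
      fix i j assume ij: "i \<in> {..<card q}" "j \<in> {..<card q}" "i \<noteq> j"
      hence "g i \<noteq> g j" using g by (auto simp: bij_betw_def inj_on_def)
      moreover obtain x K x' K' where *: "g i = (x, K)" "(x, K) \<in> p" "K = {u i..v i}"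
          "g j = (x', K')" "(x', K') \<in> p" "K' = {u j..v j}" using gi ij by (metis lessThan_iff)
      ultimately have "interior K \<inter> interior K' = {}" using pD(5)[of x K x' K'] by auto
      thus "{u i<..<v i} \<inter> {u j<..<v j} = {}" using * by (simp add: interior_atLeastAtMost_real)
    qed
    have "(\<Sum>i<card q. v i - u i) = (\<Sum>i<card q. measure lebesgue {u i<..<v i})"
      using gi by (intro sum.cong refl) fastforce
    also have "\<dots> = measure lebesgue (\<Union>i<card q. {u i<..<v i})"
      using disj by (intro measure_UNION'[symmetric])
        (auto simp: disjoint_family_on_def pairwise_def disjnt_def)
    also have "\<dots> \<le> measure lebesgue U"
    proof (rule measure_mono_fmeasurable)
      show "(\<Union>i<card q. {u i<..<v i}) \<subseteq> U"
      proof
        fix z assume "z \<in> (\<Union>i<card q. {u i<..<v i})"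
        then obtain i where "i < card q" "z \<in> {u i..v i}" by auto
        thus "z \<in> U" using gi by blast
      qed
    qed (use Um in auto)
    finally have "(\<Sum>i<card q. v i - u i) < d" using mU by simp
    moreover have "\<forall>i\<in>{..<card q}. u i \<le> v i \<and> {u i..v i} \<subseteq> {a..b}" using gi by blast
    ultimately have "(\<Sum>i<card q. \<bar>f (v i) - f (u i)\<bar>) < e"
      using d[rule_format, of "{..<card q}" u v] disj by blast
    moreover have "sum F q = (\<Sum>i<card q. F (g i))"
      using sum.reindex_bij_betw[OF g, of F] by simp
    moreover have "(\<Sum>i<card q. F (g i)) \<le> (\<Sum>i<card q. \<bar>f (v i) - f (u i)\<bar>)"
      by (intro sum_mono) (simp add: F_def u_def v_def case_prod_beta)
    ultimately show ?thesis by linarith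
  qed
  finally show "f b \<le> f a + e0" using e(2) by linarith
qed

text \<open>The antiderivative is the indefinite integral of \<open>a\<close>, extended by zero.
  Convergence of averages over boxes with corner \<open>x\<close> yields the right-hand difference
  quotients; the left-hand ones are those of the reflected function
  \<open>\<lambda>t. g (- t)\<close>, whose exceptional set is reflected back.\<close>

lemma bounded_measurable_has_antiderivative:
  fixes a :: "real \<Rightarrow> real"
  assumes meas: "a \<in> borel_measurable (lebesgue_on {T..})"
    and bnd: "\<And>t. t \<ge> T \<Longrightarrow> m \<le> a t \<and> a t \<le> L"
  obtains \<sigma> where "AE t in lebesgue. T < t \<longrightarrow> (\<sigma> has_real_derivative a t) (at t)"
    and "\<And>s t. T \<le> s \<Longrightarrow> s \<le> t \<Longrightarrow> m * (t - s) \<le> \<sigma> t - \<sigma> s \<and> \<sigma> t - \<sigma> s \<le> L * (t - s)"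
    and "\<And>S. absolutely_continuous_fun_on {T..S} \<sigma>"
proof -
  define g where "g = (\<lambda>t. if t \<in> {T..} then a t else 0)"
  define B where "B = max \<bar>m\<bar> \<bar>L\<bar>"
  have gB: "\<bar>g t\<bar> \<le> B" for t
    using bnd[of t] by (auto simp: g_def B_def)
  have "g \<in> borel_measurable lebesgue"
    unfolding g_def using meas by (intro borel_measurable_if_I) auto
  hence gm: "g \<in> borel_measurable (lebesgue_on {u..v})" for u v
    by (rule measurable_restrict_space1)
  have int: "g integrable_on {u..v}" for u v
    by (rule measurable_bounded_by_integrable_imp_integrable_real[OF gm integrable_const_ivl[of B] gB])
      simp
  have intc: "g integrable_on cbox u v" for u v
    unfolding cbox_interval by (rule int)
  have intc': "(\<lambda>t. g (- t)) integrable_on cbox u v" for u v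
    using int[of "-v" "-u"] Henstock_Kurzweil_Integration.integrable_reflect_real[of g "-u" "-v"] by simp
  define \<sigma> where "\<sigma> = (\<lambda>t. integral {T..t} g)"
  have diff: "\<sigma> t - \<sigma> s = integral {s..t} g" if "T \<le> s" "s \<le> t" for s t
    using Henstock_Kurzweil_Integration.integral_combine[OF that int] by (simp add: \<sigma>_def)
  have bounds: "m * (t - s) \<le> \<sigma> t - \<sigma> s \<and> \<sigma> t - \<sigma> s \<le> L * (t - s)" if st: "T \<le> s" "s \<le> t" for s t
  proof -
    have *: "m \<le> g z \<and> g z \<le> L" if "z \<in> {s..t}" for z
      using that st bnd[of z] by (auto simp: g_def)
    have "integral {s..t} (\<lambda>_. m) \<le> integral {s..t} g"
      using * by (intro integral_le int) auto
    moreover have "integral {s..t} g \<le> integral {s..t} (\<lambda>_. L)"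
      using * by (intro integral_le int) auto
    ultimately show ?thesis using st by (simp add: diff mult.commute)
  qed
  obtain N1 where N1: "negligible N1" "\<And>x e. x \<notin> N1 \<Longrightarrow> 0 < e \<Longrightarrow>
      \<exists>d>0. \<forall>h. 0 < h \<and> h < d \<longrightarrow> norm (integral (cbox x (x + h *\<^sub>R One)) g /\<^sub>R h ^ DIM(real) - g x) < e"
    by (rule integrable_ccontinuous_explicit[of g, OF intc]) (rule that; simp)
  obtain N2 where N2: "negligible N2" "\<And>x e. x \<notin> N2 \<Longrightarrow> 0 < e \<Longrightarrow>
      \<exists>d>0. \<forall>h. 0 < h \<and> h < d \<longrightarrow>
        norm (integral (cbox x (x + h *\<^sub>R One)) (\<lambda>t. g (- t)) /\<^sub>R h ^ DIM(real) - g (- x)) < e"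
    by (rule integrable_ccontinuous_explicit[of "\<lambda>t. g (- t)", OF intc']) (rule that; simp)
  have "negligible (uminus ` N2)"
    using N2(1) by (intro negligible_differentiable_image_negligible)
      (auto intro!: derivative_intros)
  hence "negligible (N1 \<union> uminus ` N2)" using N1 by auto
  hence "AE t in lebesgue. t \<notin> N1 \<union> uminus ` N2"
    unfolding negligible_iff_null_sets by (rule AE_not_in)
  hence "AE t in lebesgue. T < t \<longrightarrow> (\<sigma> has_real_derivative a t) (at t)"
  proof eventually_elim
    case (elim t)
    hence t: "t \<notin> N1" "- t \<notin> N2" by (auto simp: image_iff)
    show ?case
    proof
      assume T: "T < t"
      show "(\<sigma> has_real_derivative a t) (at t)"
        unfolding DERIV_def LIM_def
      proof (intro allI impI)
        fix e :: real assume "e > 0"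
        obtain d1 where d1: "d1 > 0" "\<And>h. 0 < h \<Longrightarrow> h < d1 \<Longrightarrow> \<bar>integral {t..t + h} g / h - a t\<bar> < e"
          using N1(2)[OF t(1) \<open>e > 0\<close>] T by (auto simp: g_def cbox_interval divide_inverse_commute)
        obtain d2 where d2: "d2 > 0"
          "\<And>h. 0 < h \<Longrightarrow> h < d2 \<Longrightarrow> \<bar>integral {-t..-t + h} (\<lambda>t. g (- t)) / h - a t\<bar> < e"
          using N2(2)[OF t(2) \<open>e > 0\<close>] T by (auto simp: g_def cbox_interval divide_inverse_commute)
        show "\<exists>s>0. \<forall>x. x \<noteq> 0 \<and> dist x 0 < s \<longrightarrow> dist ((\<sigma> (t + x) - \<sigma> t) / x) (a t) < e"
        proof (intro exI[of _ "min (min d1 d2) (t - T)"] conjI allI impI)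
          fix h :: real assume h: "h \<noteq> 0 \<and> dist h 0 < min (min d1 d2) (t - T)"
          show "dist ((\<sigma> (t + h) - \<sigma> t) / h) (a t) < e"
          proof (cases "h > 0")
            case True
            thus ?thesis using d1(2)[of h] h T diff[of t "t + h"] by (simp add: dist_real_def)
          next
            case False
            have "integral {-t..-t + -h} (\<lambda>t. g (- t)) = integral {t + h..t} g"
              using Henstock_Kurzweil_Integration.integral_reflect_real[of t "t + h" g] by (simp add: algebra_simps)
            moreover have "\<sigma> t - \<sigma> (t + h) = integral {t + h..t} g"
              using h False by (intro diff) (auto simp: dist_real_def)
            hence "(\<sigma> (t + h) - \<sigma> t) / h = integral {t + h..t} g / - h"
              by (simp add: minus_divide_left[symmetric] divide_minus_right)
                (metis minus_diff_eq minus_divide_left)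
            ultimately show ?thesis using d2(2)[of "-h"] h False by (simp add: dist_real_def)
          qed
        qed (use d1 d2 T in auto)
      qed
    qed
  qed
  moreover have "absolutely_continuous_fun_on {T..S} \<sigma>" for S
  proof (rule absolutely_continuous_fun_on_lipschitz)
    have *: "\<bar>\<sigma> t - \<sigma> s\<bar> \<le> B * \<bar>t - s\<bar>" if "T \<le> s" "s \<le> t" for s t
    proof -
      have "L * (t - s) \<le> B * (t - s)" "- B * (t - s) \<le> m * (t - s)"
        using that by (intro mult_right_mono; auto simp: B_def)+
      thus ?thesis using bounds[OF that] that by auto
    qed
    show "B-lipschitz_on {T..S} \<sigma>"
    proof (rule lipschitz_onI)
      fix s t assume "s \<in> {T..S}" "t \<in> {T..S}"
      thus "dist (\<sigma> s) (\<sigma> t) \<le> B * dist s t"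
        using *[of s t] *[of t s] by (cases "s \<le> t") (auto simp: dist_real_def abs_minus_commute)
    qed (simp add: B_def)
  qed
  ultimately show thesis using bounds by (intro that)
qed

subsection \<open>Delayed negative feedback\<close>

text \<open>With \<open>w = exp (- \<tau>) / k\<close> this is \<open>1 + u \<le> exp u\<close> at
  \<open>u = z - s - w\<close>, multiplied by \<open>(1 + k) * exp s\<close>. Equality holds at
  \<open>z = s + w\<close>, so the coefficient of \<open>exp z\<close> is the exact maximum of the
  left side divided by \<open>exp z\<close>.\<close>

lemma exp_tangent_bound:
  fixes k s \<tau> z :: real
  assumes k: "k > 0" and s: "(1 + k) * exp s = k * exp \<tau>"
  shows "(exp s - 1) + k * (exp \<tau> * (z - s) - (exp z - exp s))
       \<le> ((1 + k) * exp (- exp (- \<tau>) / k) - k) * exp z"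
proof -
  define w where "w = exp (- \<tau>) / k"
  have w: "w * ((1 + k) * exp s) = 1"
    unfolding s w_def using k by (simp flip: exp_add)
  have "(1 + k) * exp s * (1 + (z - s - w)) \<le> (1 + k) * exp s * exp (z - s - w)"
    using k by (intro mult_left_mono exp_ge_add_one_self) auto
  also have "\<dots> = (1 + k) * exp (- w) * exp z"
    by (simp flip: exp_add)
  finally have *: "(1 + k) * exp s * (1 + (z - s)) - 1 \<le> (1 + k) * exp (- w) * exp z"
    using w by (simp add: algebra_simps)
  have "(1 + k) * exp s * (z - s) = k * exp \<tau> * (z - s)" using s by simp
  with * show ?thesis by (simp add: w_def algebra_simps)
qed

text \<open>The parameter \<open>s\<^sub>1\<close> is the \<open>\<sigma>\<close>-time after a zero of \<open>y\<close> at which the two bounds on the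
  delayed value used in \<open>excursion_bound\<close> below coincide. Assuming \<open>s\<^sub>1 \<ge> 0\<close> is no loss, since
  \<open>\<tau>\<close> may be enlarged.\<close>

locale delayed_feedback =
  fixes y \<sigma> a \<kappa> h :: "real \<Rightarrow> real" and T k \<tau> s\<^sub>1 :: real
  assumes ac_y: "\<And>S. absolutely_continuous_fun_on {T..S} y"
    and ac_\<sigma>: "\<And>S. absolutely_continuous_fun_on {T..S} \<sigma>"
    and ode: "AE t in lebesgue. T < t \<longrightarrow> 0 < a t \<and> (\<sigma> has_real_derivative a t) (at t) \<and>
          (y has_real_derivative - a t * (y t + \<kappa> t * y (h t))) (at t)"
    and gain: "\<And>t. T \<le> t \<Longrightarrow> 0 \<le> \<kappa> t \<and> \<kappa> t \<le> k"
    and \<sigma>_mono: "\<And>s t. T \<le> s \<Longrightarrow> s < t \<Longrightarrow> \<sigma> s < \<sigma> t"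
    and \<sigma>_top: "filterlim \<sigma> at_top at_top"
    and h_le: "\<And>t. T \<le> t \<Longrightarrow> h t \<le> t"
    and h_top: "filterlim h at_top at_top"
    and lag: "\<And>t. T \<le> h t \<Longrightarrow> T \<le> t \<Longrightarrow> \<sigma> t - \<sigma> (h t) \<le> \<tau>"
    and k_pos: "k > 0"
    and s\<^sub>1: "0 \<le> s\<^sub>1" "(1 + k) * exp s\<^sub>1 = k * exp \<tau>"
begin

definition contraction :: real where
  "contraction = k * ((1 + k) * exp (- exp (- \<tau>) / k) - k)"

lemma \<sigma>_mono': "T \<le> s \<Longrightarrow> s \<le> t \<Longrightarrow> \<sigma> s \<le> \<sigma> t"
  using \<sigma>_mono[of s t] by (cases "s = t") auto

lemma cont_y: "continuous_on {T..S} y" and cont_\<sigma>: "continuous_on {T..S} \<sigma>"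
  using ac_y ac_\<sigma> by (auto intro: absolutely_continuous_fun_on_imp_continuous_on)

text \<open>As \<open>exp \<sigma>\<close> is the integrating factor of the decay, the derivative of
  \<open>exp \<sigma> * y\<close> is \<open>a\<close> times the weighted feedback, while that of
  \<open>G\<close> along \<sigma> is \<open>a\<close> times \<open>G'\<close>. The common factor
  \<open>a\<close> cancels from the comparison.\<close>

lemma weighted_nonincreasing:
  fixes G G' :: "real \<Rightarrow> real"
  assumes st: "T \<le> s" "s \<le> t"
    and G: "\<And>z. (G has_real_derivative G' z) (at z)" "continuous_on UNIV G'"
    and le: "\<And>u. s < u \<Longrightarrow> u < t \<Longrightarrow> - \<kappa> u * y (h u) * exp (\<sigma> u) \<le> G' (\<sigma> u)"
  shows "exp (\<sigma> t) * y t - G (\<sigma> t) \<le> exp (\<sigma> s) * y s - G (\<sigma> s)"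
proof (rule absolutely_continuous_fun_on_nonincreasing[OF _ st(2), where f = "\<lambda>u. exp (\<sigma> u) * y u - G (\<sigma> u)"])
  have ac: "absolutely_continuous_fun_on {s..t} \<sigma>" "absolutely_continuous_fun_on {s..t} y"
    using st by (auto intro: absolutely_continuous_fun_on_subset[OF ac_\<sigma>, of _ t]
        absolutely_continuous_fun_on_subset[OF ac_y, of _ t])
  show "absolutely_continuous_fun_on {s..t} (\<lambda>u. exp (\<sigma> u) * y u - G (\<sigma> u))"
  proof (intro absolutely_continuous_fun_on_diff absolutely_continuous_fun_on_mult ac)
    show "absolutely_continuous_fun_on {s..t} (\<lambda>u. exp (\<sigma> u))"
      by (rule absolutely_continuous_fun_on_compose[OF ac(1) DERIV_exp]) (intro continuous_intros)
    show "absolutely_continuous_fun_on {s..t} (\<lambda>u. G (\<sigma> u))"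
      by (rule absolutely_continuous_fun_on_compose[OF ac(1) G(1)])
        (rule continuous_on_subset[OF G(2)], simp)
  qed
  show "AE u in lebesgue. s < u \<and> u < t \<longrightarrow>
          (\<exists>D\<le>0. ((\<lambda>u. exp (\<sigma> u) * y u - G (\<sigma> u)) has_real_derivative D) (at u))"
    using ode
  proof eventually_elim
    case (elim u)
    show ?case
    proof
      assume u: "s < u \<and> u < t"
      hence d: "0 < a u" "(\<sigma> has_real_derivative a u) (at u)"
        "(y has_real_derivative - a u * (y u + \<kappa> u * y (h u))) (at u)"
        using elim st by auto
      show "\<exists>D\<le>0. ((\<lambda>u. exp (\<sigma> u) * y u - G (\<sigma> u)) has_real_derivative D) (at u)"
      proof (intro exI conjI)
        show "((\<lambda>u. exp (\<sigma> u) * y u - G (\<sigma> u)) has_real_derivative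
           a u * (- \<kappa> u * y (h u) * exp (\<sigma> u) - G' (\<sigma> u))) (at u)"
          by (rule derivative_eq_intros d DERIV_chain2[OF G(1)] refl)+ (simp add: algebra_simps)
        show "a u * (- \<kappa> u * y (h u) * exp (\<sigma> u) - G' (\<sigma> u)) \<le> 0"
          using le[of u] u d(1) by (intro mult_nonneg_nonpos) auto
      qed
    qed
  qed
qed

lemma decay:
  assumes "T \<le> s" "s \<le> t" and "\<And>u. s < u \<Longrightarrow> u < t \<Longrightarrow> 0 \<le> y (h u)"
  shows "exp (\<sigma> t) * y t \<le> exp (\<sigma> s) * y s"
proof -
  have "- \<kappa> u * y (h u) * exp (\<sigma> u) \<le> 0" if "s < u" "u < t" for u
    using assms gain[of u] that by (simp add: mult_nonneg_nonneg)
  thus ?thesis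
    using weighted_nonincreasing[of s t "\<lambda>_. 0" "\<lambda>_. 0"] assms(1,2) by auto
qed

lemma neg_feedback_le:
  assumes "T \<le> u" "- Y \<le> y (h u)" "0 \<le> Y"
  shows "- \<kappa> u * y (h u) * exp (\<sigma> u) \<le> k * Y * exp (\<sigma> u)"
proof -
  have "\<kappa> u * - y (h u) \<le> \<kappa> u * Y" using assms gain[of u] by (intro mult_left_mono) auto
  also have "\<dots> \<le> k * Y" using assms gain[of u] by (intro mult_right_mono) auto
  finally show ?thesis by (intro mult_right_mono) auto
qed

text \<open>The constant feedback \<open>- Q\<close> has equilibrium \<open>k * Q\<close>. Forwards
  from a zero of \<open>y\<close> this bounds \<open>y\<close> from above; read backwards from a
  zero it bounds the past of \<open>y\<close> from below.\<close>

lemma exp_growth: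
  assumes st: "T \<le> s" "s \<le> t" and Q: "0 \<le> Q" "\<And>u. s < u \<Longrightarrow> u < t \<Longrightarrow> - Q \<le> y (h u)"
  shows "exp (\<sigma> t) * (y t - k * Q) \<le> exp (\<sigma> s) * (y s - k * Q)"
proof -
  have "exp (\<sigma> t) * y t - k * Q * exp (\<sigma> t) \<le> exp (\<sigma> s) * y s - k * Q * exp (\<sigma> s)"
  proof (rule weighted_nonincreasing[OF st, where G' = "\<lambda>z. k * Q * exp z"])
    show "((\<lambda>z. k * Q * exp z) has_real_derivative k * Q * exp z) (at z)" for z
      by (rule derivative_eq_intros refl)+ simp
    show "- \<kappa> u * y (h u) * exp (\<sigma> u) \<le> k * Q * exp (\<sigma> u)" if "s < u" "u < t" for u
      using that st Q by (intro neg_feedback_le) auto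
  qed (intro continuous_intros)
  thus ?thesis by (simp add: algebra_simps)
qed

text \<open>Starting from a zero \<open>t\<^sub>0\<close>, the delayed value is at least \<open>- Q\<close> and, by the growth bound run
  backwards from \<open>t\<^sub>0\<close>, also at least \<open>- k Q (exp (\<tau> - z) - 1)\<close> where \<open>z = \<sigma> t - \<sigma> t\<^sub>0\<close>; the two
  bounds coincide at \<open>z = s\<^sub>1\<close>, and the feedback acts downwards for \<open>z \<ge> \<tau>\<close>.\<close>

lemma excursion_bound:
  assumes Q: "0 \<le> Q"
    and U: "T \<le> U" "\<And>t. U \<le> t \<Longrightarrow> T \<le> h t \<and> - Q \<le> y (h t)"
    and t0: "\<And>t. t0 \<le> t \<Longrightarrow> U \<le> h t" "U \<le> t0" "y t0 = 0"
    and t: "t0 \<le> t" "\<And>u. t0 < u \<Longrightarrow> u \<le> t \<Longrightarrow> 0 < y u"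
  shows "y t \<le> contraction * Q"
proof -
  define e0 where "e0 = exp (\<sigma> t0)"
  have e0: "e0 > 0" by (simp add: e0_def)
  have Q': "- Q \<le> y (h u)" if "U \<le> u" for u using U that by blast
  have history: "k * Q * (1 - exp (\<sigma> t0 - \<sigma> u)) \<le> y u" if "U \<le> u" "u \<le> t0" for u
  proof -
    have "exp (\<sigma> t0) * (y t0 - k * Q) \<le> exp (\<sigma> u) * (y u - k * Q)"
      using that U(1) Q Q' by (intro exp_growth) auto
    hence "- (exp (\<sigma> t0) / exp (\<sigma> u)) * (k * Q) \<le> y u - k * Q"
      using t0 by (simp add: field_simps)
    thus ?thesis by (simp add: exp_diff algebra_simps)
  qed
  have delayed: "- (k * Q * (exp (\<tau> + \<sigma> t0 - \<sigma> u) - 1)) \<le> y (h u)"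
    if u: "t0 < u" "u \<le> t" "\<sigma> u \<le> \<sigma> t0 + \<tau>" for u
  proof (cases "h u \<le> t0")
    case True
    have "\<sigma> t0 - \<sigma> (h u) \<le> \<tau> + \<sigma> t0 - \<sigma> u"
      using lag[of u] u U t0 by fastforce
    hence "exp (\<sigma> t0 - \<sigma> (h u)) \<le> exp (\<tau> + \<sigma> t0 - \<sigma> u)" by simp
    hence "k * Q * exp (\<sigma> t0 - \<sigma> (h u)) \<le> k * Q * exp (\<tau> + \<sigma> t0 - \<sigma> u)"
      using k_pos Q by (intro mult_left_mono) auto
    thus ?thesis using history[of "h u"] True t0(1)[of u] u by (simp add: algebra_simps)
  next
    case False
    have "0 \<le> k * Q * (exp (\<tau> + \<sigma> t0 - \<sigma> u) - 1)"
      using k_pos Q u by (intro mult_nonneg_nonneg) auto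
    moreover have "h u \<le> u" using h_le u U t0 by auto
    ultimately show ?thesis using t(2)[of "h u"] False u by auto
  qed
  define z where "z = (\<lambda>u. \<sigma> u - \<sigma> t0)"
  have T: "T \<le> t0" using U(1) t0(2) by simp
  have z0: "z t0 = 0" by (simp add: z_def)
  have z_mono: "z u \<le> z v" if "t0 \<le> u" "u \<le> v" for u v
    using \<sigma>_mono'[of u v] that T by (auto simp: z_def)
  have E: "exp (\<sigma> u) = e0 * exp (z u)" for u by (simp add: e0_def z_def flip: exp_add)
  have cont_z: "continuous_on {t0..u} z" for u
    unfolding z_def using T by (intro continuous_intros continuous_on_subset[OF cont_\<sigma>, of _ u]) auto
  have reach: "\<exists>v. t0 \<le> v \<and> v \<le> u \<and> z v = w" if "t0 \<le> u" "0 \<le> w" "w \<le> z u" for u w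
    using IVT'[of z t0 w u] that z0 cont_z by auto
  have first: "exp (z u) * y u \<le> k * Q * (exp (z u) - 1)" if "t0 \<le> u" for u
  proof -
    have "exp (\<sigma> u) * (y u - k * Q) \<le> exp (\<sigma> t0) * (y t0 - k * Q)"
      using that T Q Q' t0 by (intro exp_growth) auto
    hence "e0 * (exp (z u) * (y u - k * Q)) \<le> e0 * - (k * Q)"
      using t0 by (simp add: E z0 mult.assoc)
    hence "exp (z u) * (y u - k * Q) \<le> - (k * Q)"
      using e0 by (simp only: mult_le_cancel_left_pos)
    thus ?thesis by (simp add: algebra_simps)
  qed
  \<comment> \<open>For \<open>s\<^sub>1 \<le> w \<le> \<tau>\<close>, \<open>k * Q * I w\<close>
    bounds \<open>exp (z u) * y u\<close> when \<open>z u = w\<close>: the first term is the growth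
    up to \<open>s\<^sub>1\<close>, the second the integral of
    \<open>k * (exp (\<tau> - v) - 1) * exp v\<close> over \<open>v\<close> from
    \<open>s\<^sub>1\<close> to \<open>w\<close>.\<close>
  define I where "I = (\<lambda>w. (exp s\<^sub>1 - 1) + k * (exp \<tau> * (w - s\<^sub>1) - (exp w - exp s\<^sub>1)))"
  have kQ: "0 \<le> k * Q" using k_pos Q by simp
  have I: "k * Q * I w \<le> contraction * Q * exp w" for w
    using mult_left_mono[OF exp_tangent_bound[OF k_pos s\<^sub>1(2), of w] kQ]
    by (simp add: I_def contraction_def algebra_simps)
  have s\<^sub>1_le: "s\<^sub>1 \<le> \<tau>"
  proof -
    have "k * exp s\<^sub>1 \<le> k * exp \<tau>" using s\<^sub>1(2)[symmetric] by (simp add: algebra_simps)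
    thus ?thesis using k_pos by simp
  qed
  \<comment> \<open>Up to \<open>s\<^sub>1\<close> the bound \<open>1 - exp (- z u)\<close>
    increases with \<open>z u\<close>, so its value at \<open>s\<^sub>1\<close> suffices; that value
    is \<open>I s\<^sub>1 * exp (- s\<^sub>1)\<close>.\<close>
  have early: "y u \<le> contraction * Q" if u: "t0 \<le> u" "z u \<le> s\<^sub>1" for u
  proof -
    have "y u \<le> k * Q * (1 - exp (- z u))"
      using first[OF u(1)] by (simp add: exp_minus field_simps)
    also have "\<dots> \<le> k * Q * (1 - exp (- s\<^sub>1))"
      using kQ u by (intro mult_left_mono) auto
    also have "\<dots> = k * Q * I s\<^sub>1 * exp (- s\<^sub>1)"
      by (simp add: I_def exp_minus field_simps)
    also have "\<dots> \<le> contraction * Q * exp s\<^sub>1 * exp (- s\<^sub>1)"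
      by (intro mult_right_mono I) auto
    also have "\<dots> = contraction * Q" by (simp add: exp_minus)
    finally show ?thesis .
  qed
  have middle: "y u \<le> contraction * Q" if u: "t0 \<le> u" "u \<le> t" "s\<^sub>1 \<le> z u" "z u \<le> \<tau>" for u
  proof -
    obtain v where v: "t0 \<le> v" "v \<le> u" "z v = s\<^sub>1" using reach u s\<^sub>1 by blast
    define G where "G = (\<lambda>x. k * Q * k * (e0 * exp \<tau> * x - exp x))"
    have "exp (\<sigma> u) * y u - G (\<sigma> u) \<le> exp (\<sigma> v) * y v - G (\<sigma> v)"
    proof (rule weighted_nonincreasing[where G' = "\<lambda>x. k * Q * k * (e0 * exp \<tau> - exp x)"])
      show "(G has_real_derivative k * Q * k * (e0 * exp \<tau> - exp x)) (at x)" for x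
        unfolding G_def by (rule derivative_eq_intros refl)+ simp
      fix w assume w: "v < w" "w < u"
      have "z w \<le> \<tau>" using z_mono[of w u] w v u by auto
      hence "- (k * Q * (exp (\<tau> + \<sigma> t0 - \<sigma> w) - 1)) \<le> y (h w)"
        using w v u by (intro delayed) (auto simp: z_def)
      moreover have "0 \<le> k * Q * (exp (\<tau> + \<sigma> t0 - \<sigma> w) - 1)"
        using \<open>z w \<le> \<tau>\<close> by (intro mult_nonneg_nonneg[OF kQ]) (auto simp: z_def)
      ultimately have "- \<kappa> w * y (h w) * exp (\<sigma> w) \<le> k * (k * Q * (exp (\<tau> + \<sigma> t0 - \<sigma> w) - 1)) * exp (\<sigma> w)"
        using w v T by (intro neg_feedback_le) auto
      also have "exp (\<tau> + \<sigma> t0 - \<sigma> w) * exp (\<sigma> w) = e0 * exp \<tau>"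
        by (simp add: e0_def flip: exp_add)
      hence "k * (k * Q * (exp (\<tau> + \<sigma> t0 - \<sigma> w) - 1)) * exp (\<sigma> w) = k * Q * k * (e0 * exp \<tau> - exp (\<sigma> w))"
        by (simp add: algebra_simps)
      finally show "- \<kappa> w * y (h w) * exp (\<sigma> w) \<le> k * Q * k * (e0 * exp \<tau> - exp (\<sigma> w))" .
    qed (use v T in \<open>auto intro!: continuous_intros\<close>)
    hence "exp (\<sigma> u) * y u \<le> exp (\<sigma> v) * y v + (G (\<sigma> u) - G (\<sigma> v))" by simp
    also have "G (\<sigma> u) - G (\<sigma> v) = e0 * (k * Q * k * (exp \<tau> * (z u - z v) - (exp (z u) - exp (z v))))"
      unfolding G_def E by (simp add: z_def algebra_simps)
    finally have "e0 * (exp (z u) * y u)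
         \<le> e0 * (exp s\<^sub>1 * y v + k * Q * k * (exp \<tau> * (z u - s\<^sub>1) - (exp (z u) - exp s\<^sub>1)))"
      unfolding E v(3) by (simp add: algebra_simps)
    hence "exp (z u) * y u
         \<le> exp s\<^sub>1 * y v + k * Q * k * (exp \<tau> * (z u - s\<^sub>1) - (exp (z u) - exp s\<^sub>1))"
      using e0 by (simp only: mult_le_cancel_left_pos)
    also have "exp s\<^sub>1 * y v \<le> k * Q * (exp s\<^sub>1 - 1)" using first[OF v(1)] v(3) by simp
    also have "k * Q * (exp s\<^sub>1 - 1) + k * Q * k * (exp \<tau> * (z u - s\<^sub>1) - (exp (z u) - exp s\<^sub>1)) = k * Q * I (z u)"
      by (simp add: I_def algebra_simps)
    also have "\<dots> \<le> contraction * Q * exp (z u)" by (rule I)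
    finally have "exp (z u) * y u \<le> exp (z u) * (contraction * Q)" by (simp add: mult.commute)
    thus ?thesis by simp
  qed
  consider "z t \<le> s\<^sub>1" | "s\<^sub>1 \<le> z t" "z t \<le> \<tau>" | "\<tau> \<le> z t" by linarith
  thus ?thesis
  proof cases
    case 1
    thus ?thesis using early t by blast
  next
    case 2
    thus ?thesis using middle t by blast
  next
    case 3
    then obtain v where v: "t0 \<le> v" "v \<le> t" "z v = \<tau>"
      using reach[of t \<tau>] t s\<^sub>1 s\<^sub>1_le by auto
    have yv: "y v \<le> contraction * Q" using middle[of v] v s\<^sub>1_le by simp
    have "0 \<le> y v" using t v t0 by (cases "v = t0") (auto intro: less_imp_le)
    have "exp (\<sigma> t) * y t \<le> exp (\<sigma> v) * y v"
    proof (rule decay)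
      fix u assume u: "v < u" "u < t"
      have "\<tau> \<le> z u" using z_mono[of v u] u v by auto
      moreover have "\<sigma> u - \<sigma> (h u) \<le> \<tau>" "T \<le> h u" "h u \<le> u"
        using u v U t0 lag[of u] h_le[of u] by fastforce+
      ultimately have "\<not> h u < t0" using \<sigma>_mono[of "h u" t0] by (auto simp: z_def)
      thus "0 \<le> y (h u)"
        using t(2)[of "h u"] \<open>h u \<le> u\<close> u t0 by (cases "h u = t0") (auto intro: less_imp_le)
    qed (use v T in auto)
    also have "\<dots> \<le> exp (\<sigma> t) * y v"
      using \<sigma>_mono'[of v t] v T \<open>0 \<le> y v\<close> by (intro mult_right_mono) auto
    finally show ?thesis using yv by simp
  qed
qed

text \<open>At \<open>z = s\<^sub>1\<close> the left side of the tangent bound reduces to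
  \<open>exp s\<^sub>1 - 1\<close>, where the sign of \<open>s\<^sub>1\<close> enters.\<close>

lemma contraction_nonneg: "0 \<le> contraction"
proof -
  have "0 \<le> exp s\<^sub>1 - 1" using s\<^sub>1 by simp
  also have "\<dots> \<le> ((1 + k) * exp (- exp (- \<tau>) / k) - k) * exp s\<^sub>1"
    using exp_tangent_bound[OF k_pos s\<^sub>1(2), of s\<^sub>1] by simp
  finally show ?thesis
    using k_pos by (simp add: contraction_def zero_le_mult_iff)
qed

text \<open>A positive value at \<open>t\<close> either belongs to an excursion that starts at a
  late zero, or \<open>y\<close> has been positive on a long interval up to \<open>t\<close> and has
  decayed freely ever since; \<open>e\<close> pays for the second case.\<close>

lemma eventually_le_contraction:
  assumes Q: "0 \<le> Q" "eventually (\<lambda>t. - Q \<le> y t) at_top" and e: "e > 0"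
  shows "eventually (\<lambda>t. y t \<le> contraction * Q + e) at_top"
proof -
  obtain U1 where U1: "T \<le> U1" "\<And>t. U1 \<le> t \<Longrightarrow> - Q \<le> y t"
    using eventually_conj[OF Q(2) eventually_ge_at_top[of T]]
    unfolding eventually_at_top_linorder by auto
  have delay: "\<exists>V\<ge>U. \<forall>t\<ge>V. U \<le> h t" for U
  proof -
    obtain V where "\<And>t. V \<le> t \<Longrightarrow> U \<le> h t"
      using h_top unfolding filterlim_at_top eventually_at_top_linorder by meson
    thus ?thesis by (intro exI[of _ "max U V"]) auto
  qed
  \<comment> \<open>Each threshold allows one more application of \<open>h\<close>. Zeros are sought
    beyond \<open>U3\<close>; after such a zero delayed arguments lie beyond \<open>U2\<close>, and
    their own delayed arguments beyond \<open>U1\<close>, where \<open>- Q\<close> is a lower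
    bound.\<close>
  obtain U2 where U2: "U1 \<le> U2" "\<And>t. U2 \<le> t \<Longrightarrow> U1 \<le> h t" using delay[of U1] by blast
  obtain U3 where U3: "U2 \<le> U3" "\<And>t. U3 \<le> t \<Longrightarrow> U2 \<le> h t" using delay[of U2] by blast
  obtain U4 where U4: "U3 \<le> U4" "\<And>t. U4 \<le> t \<Longrightarrow> U3 \<le> h t" using delay[of U3] by blast
  have "filterlim (\<lambda>t. exp (\<sigma> t)) at_top at_top"
    by (rule filterlim_compose[OF exp_at_top \<sigma>_top])
  hence "eventually (\<lambda>t. exp (\<sigma> U4) * y U4 / e \<le> exp (\<sigma> t) \<and> U4 \<le> t) at_top"
    unfolding filterlim_at_top by (intro eventually_conj eventually_ge_at_top) blast
  thus ?thesis
  proof eventually_elim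
    case (elim t)
    have cQ: "0 \<le> contraction * Q" using contraction_nonneg Q by simp
    define S where "S = {s \<in> {U3..t}. y s \<in> {..0}}"
    consider "y t \<le> 0" | "y t > 0" "S = {}" | "y t > 0" "S \<noteq> {}" by linarith
    thus ?case
    proof cases
      case 1
      thus ?thesis using cQ e by simp
    next
      case 2
      have "exp (\<sigma> t) * y t \<le> exp (\<sigma> U4) * y U4"
      proof (rule decay)
        fix u assume u: "U4 < u" "u < t"
        have "U3 \<le> h u" "h u \<le> u" using U1 U2 U3 U4 u by (auto intro: h_le)
        hence "h u \<notin> S \<and> h u \<in> {U3..t}" using 2(2) u by auto
        thus "0 \<le> y (h u)" unfolding S_def by auto
      qed (use U1 U2 U3 U4 elim in auto)
      also have "\<dots> \<le> exp (\<sigma> t) * e" using elim e by (simp add: field_simps)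
      finally show ?thesis using cQ by simp
    next
      case 3
      have cont: "continuous_on {U3..t} y"
        using U1 U2 U3 by (intro continuous_on_subset[OF cont_y, of _ t]) auto
      have "closed S"
        unfolding S_def using continuous_closed_preimage[OF cont, of "{..0}"]
        by (simp add: vimage_def Int_def)
      moreover have "bounded S" by (rule bounded_subset[of "{U3..t}"]) (auto simp: S_def)
      ultimately obtain t0 where t0: "t0 \<in> S" "\<And>s. s \<in> S \<Longrightarrow> s \<le> t0"
        using compact_attains_sup[of S] 3(2) by (auto simp: compact_eq_bounded_closed)
      have t0': "U3 \<le> t0" "t0 \<le> t" "y t0 \<le> 0" using t0(1) by (auto simp: S_def)
      \<comment> \<open>This zero belongs to \<open>S\<close>, so it cannot lie after
        \<open>t0\<close>: the last nonpositive time is itself a zero.\<close>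
      obtain s where s: "t0 \<le> s" "s \<le> t" "y s = 0"
        using IVT'[of y t0 0 t] t0' 3(1) continuous_on_subset[OF cont, of "{t0..t}"] by auto
      have "s \<le> t0" using s t0' by (intro t0(2)) (auto simp: S_def)
      hence "y t0 = 0" using s by simp
      have "y t \<le> contraction * Q"
      proof (rule excursion_bound)
        show "T \<le> h t \<and> - Q \<le> y (h t)" if "U2 \<le> t" for t
          using U1 U2(2)[OF that] by auto
        show "0 < y u" if "t0 < u" "u \<le> t" for u
          using t0(2)[of u] that t0' unfolding S_def by force
      qed (use U1 U2 U3 Q t0' \<open>y t0 = 0\<close> in auto)
      thus ?thesis using e by simp
    qed
  qed
qed

lemma uminus_delayed_feedback: "delayed_feedback (\<lambda>t. - y t) \<sigma> a \<kappa> h T k \<tau> s\<^sub>1"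
proof (unfold_locales)
  show "absolutely_continuous_fun_on {T..S} (\<lambda>t. - y t)" for S
    by (rule absolutely_continuous_fun_on_dominated[OF ac_y ac_y, where L = 1]) (auto simp: abs_if)
  show "AE t in lebesgue. T < t \<longrightarrow> 0 < a t \<and> (\<sigma> has_real_derivative a t) (at t) \<and>
      ((\<lambda>t. - y t) has_real_derivative - a t * (- y t + \<kappa> t * - y (h t))) (at t)"
    using ode
  proof eventually_elim
    case (elim t)
    thus ?case using DERIV_minus[of y "- a t * (y t + \<kappa> t * y (h t))" t UNIV]
      by (auto simp: algebra_simps)
  qed
qed (use ac_\<sigma> gain \<sigma>_mono \<sigma>_top h_le h_top lag k_pos s\<^sub>1 in auto)

lemma tendsto_zero:
  assumes less: "contraction < 1" and bdd: "eventually (\<lambda>t. \<bar>y t\<bar> \<le> B) at_top"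
  shows "(y \<longlongrightarrow> 0) at_top"
proof -
  \<comment> \<open>\<open>contraction\<close> depends on \<open>k\<close> and \<tau> only, so the
    mirrored equation has the same constant and its upper bounds are lower bounds for
    \<open>y\<close>.\<close>
  interpret neg: delayed_feedback "\<lambda>t. - y t" \<sigma> a \<kappa> h T k \<tau> s\<^sub>1
    by (rule uminus_delayed_feedback)
  \<comment> \<open>The contraction constant plus half its distance to 1; that half, times the
    current bound, is spent on the slack \<open>e\<close> above.\<close>
  define q where "q = (1 + contraction) / 2"
  have q: "0 \<le> q" "q < 1" using less contraction_nonneg by (auto simp: q_def)
  have shrink: "eventually (\<lambda>t. \<bar>y t\<bar> \<le> q * b) at_top"
    if b: "b > 0" "eventually (\<lambda>t. \<bar>y t\<bar> \<le> b) at_top" for b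
  proof -
    have e: "(1 - contraction) / 2 * b > 0" using b less by simp
    have "eventually (\<lambda>t. y t \<le> contraction * b + (1 - contraction) / 2 * b) at_top"
      using b by (intro eventually_le_contraction e) (auto elim!: eventually_mono)
    moreover have "eventually (\<lambda>t. - y t \<le> contraction * b + (1 - contraction) / 2 * b) at_top"
      using b by (intro neg.eventually_le_contraction e) (auto elim!: eventually_mono)
    ultimately show ?thesis
      by eventually_elim (auto simp: q_def abs_le_iff field_simps)
  qed
  define B' where "B' = max B 1"
  have B': "B' > 0" by (simp add: B'_def)
  have iterate: "eventually (\<lambda>t. \<bar>y t\<bar> \<le> ((1 + q) / 2) ^ n * B') at_top" for n
  proof (induction n)
    case 0
    show ?case using bdd by (auto simp: B'_def elim!: eventually_mono)
  next
    case (Suc n)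
    have "0 < ((1 + q) / 2) ^ n * B'" using q B' by simp
    from shrink[OF this Suc] show ?case
    proof eventually_elim
      case (elim t)
      have "q * (((1 + q) / 2) ^ n * B') \<le> (1 + q) / 2 * (((1 + q) / 2) ^ n * B')"
        using q B' by (intro mult_right_mono) auto
      with elim show ?case by (simp add: mult.assoc)
    qed
  qed
  have lim: "(\<lambda>n. ((1 + q) / 2) ^ n * B') \<longlonglongrightarrow> 0"
    using q by (intro tendsto_mult_left_zero LIMSEQ_power_zero) auto
  show ?thesis
  proof (rule tendstoI)
    fix e :: real assume "e > 0"
    with lim have "eventually (\<lambda>n. ((1 + q) / 2) ^ n * B' < e) sequentially"
      by (rule order_tendstoD)
    then obtain n where "((1 + q) / 2) ^ n * B' < e"
      by (auto simp: eventually_sequentially)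
    thus "eventually (\<lambda>t. dist (y t) 0 < e) at_top"
      using iterate[of n] by (auto elim!: eventually_mono)
  qed
qed

end

subsection \<open>The Mackey-Glass equation\<close>

definition hill :: "real \<Rightarrow> real \<Rightarrow> real" where
  "hill n u = u powr n / (1 + u powr n)"

lemma hill_nonneg: "0 \<le> hill n u" and hill_less_one: "hill n u < 1"
proof -
  have "0 < 1 + u powr n" by (rule add_pos_nonneg) simp_all
  thus "0 \<le> hill n u" "hill n u < 1" by (simp_all add: hill_def pos_divide_less_eq)
qed

lemma hill_pos: "0 < u \<Longrightarrow> 0 < hill n u"
proof -
  assume "0 < u"
  hence "0 < u powr n" by simp
  thus ?thesis by (simp add: hill_def add_pos_pos)
qed

lemma hill_less:
  assumes "0 < n" "0 \<le> u" "u < v"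
  shows "hill n u < hill n v"
proof -
  have "u powr n < v powr n" using assms by (auto intro: powr_less_mono2)
  moreover have "0 < 1 + u powr n" "0 < 1 + v powr n" by (rule add_pos_nonneg; simp)+
  ultimately show ?thesis by (simp add: hill_def divide_less_eq less_divide_eq algebra_simps)
qed

lemma hill_mono: "0 < n \<Longrightarrow> 0 \<le> u \<Longrightarrow> u \<le> v \<Longrightarrow> hill n u \<le> hill n v"
  using hill_less[of n u v] by (cases "u = v") auto

text \<open>In logarithmic coordinates the Hill function is a logistic curve.\<close>

lemma hill_exp_slope:
  assumes "0 < n" "0 < K"
  obtains \<theta> where "0 \<le> \<theta>" "\<theta> \<le> n / 4" "hill n (K * exp v) - hill n K = \<theta> * v"
proof -
  define w where "w = (\<lambda>s. K powr n * exp (n * s))"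
  have w: "w s > 0" for s using assms by (simp add: w_def)
  have hill_w: "hill n (K * exp s) = w s / (1 + w s)" for s
    using assms by (simp add: hill_def w_def powr_mult exp_powr_real mult.commute)
  define d where "d = (\<lambda>s. n * w s / (1 + w s)\<^sup>2)"
  have deriv: "((\<lambda>s. hill n (K * exp s)) has_real_derivative d s) (at s)" for s
  proof -
    have dw: "(w has_real_derivative n * w s) (at s)"
      unfolding w_def by (rule derivative_eq_intros refl)+ simp
    have "1 + w s \<noteq> 0" using w[of s] by linarith
    hence "((\<lambda>s. w s / (1 + w s)) has_real_derivative
        (n * w s * (1 + w s) - w s * (0 + n * w s)) / ((1 + w s) * (1 + w s))) (at s)"
      by (intro DERIV_divide DERIV_add dw) (auto intro: derivative_eq_intros)
    thus ?thesis by (simp add: hill_w d_def power2_eq_square algebra_simps)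
  qed
  have d: "0 \<le> d s" "d s \<le> n / 4" for s
  proof -
    show "0 \<le> d s" using w[of s] assms by (simp add: d_def)
    \<comment> \<open>The arithmetic-geometric mean inequality, source of the factor 1/4 in
      \<open>b\<^sub>0\<close>; the slope is largest where \<open>w s = 1\<close>.\<close>
    have "4 * w s \<le> (1 + w s)\<^sup>2"
      using zero_le_power2[of "1 - w s"] by (simp add: power2_eq_square algebra_simps)
    hence "n * (4 * w s) \<le> n * (1 + w s)\<^sup>2" using assms by (intro mult_left_mono) auto
    moreover have "0 < (1 + w s)\<^sup>2" using w[of s] by simp
    ultimately show "d s \<le> n / 4" by (simp add: d_def pos_divide_le_eq algebra_simps)
  qed
  consider "v = 0" | "0 < v" | "v < 0" by linarith
  thus thesis
  proof cases
    case 1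
    thus thesis using assms by (intro that[of 0]) auto
  next
    case 2
    then obtain s where "hill n (K * exp v) - hill n (K * exp 0) = (v - 0) * d s"
      using MVT2[OF 2, of "\<lambda>s. hill n (K * exp s)" d] deriv by auto
    thus thesis using d[of s] by (intro that[of "d s"]) auto
  next
    case 3
    then obtain s where "hill n (K * exp 0) - hill n (K * exp v) = (0 - v) * d s"
      using MVT2[OF 3, of "\<lambda>s. hill n (K * exp s)" d] deriv by auto
    thus thesis using d[of s] by (intro that[of "d s"]) (auto simp: algebra_simps)
  qed
qed

text \<open>The decay rate of \<open>y\<close> is \<open>r * (\<alpha> / K)\<close> times this
  quotient. Its value at 0 is the limit there, so positivity and monotonicity persist at times when
  \<open>y\<close> vanishes.\<close>

definition exp_quotient :: "real \<Rightarrow> real" where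
  "exp_quotient u = (if u = 0 then 1 else (1 - exp (- u)) / u)"

lemma exp_quotient_mult: "exp_quotient u * u = 1 - exp (- u)"
  by (simp add: exp_quotient_def)

lemma exp_quotient_measurable: "exp_quotient \<in> borel_measurable borel"
  unfolding exp_quotient_def by measurable

lemma exp_quotient_pos: "0 < exp_quotient u"
  by (cases "0 < u") (auto simp: exp_quotient_def divide_neg_neg)

text \<open>Convexity of \<open>exp\<close> between 0 and \<open>- z\<close>. As \<open>z\<close>
  may have either sign, \<open>s = u / C\<close> and \<open>s = u / c\<close> give the monotonicity
  of \<open>exp_quotient\<close> on both sides of 0.\<close>

lemma exp_chord:
  assumes "0 \<le> s" "s \<le> (1 :: real)"
  shows "s * (1 - exp (- z)) \<le> 1 - exp (- (s * z))"
proof -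
  have "exp ((1 - s) *\<^sub>R 0 + s *\<^sub>R (- z)) \<le> (1 - s) * exp 0 + s * exp (- z)"
    by (rule convex_onD[OF exp_convex]) (use assms in auto)
  thus ?thesis by (simp add: algebra_simps)
qed

text \<open>The chord inequality compares values on the same side of 0, and the value 1 separates
  the two sides.\<close>

lemma exp_quotient_antimono:
  assumes "c < 0" "0 < C" "c \<le> u" "u \<le> C"
  shows "exp_quotient C \<le> exp_quotient u" "exp_quotient u \<le> exp_quotient c"
proof -
  have le_1: "exp_quotient v \<le> 1" if "0 \<le> v" for v
    using that exp_ge_add_one_self[of "-v"] by (auto simp: exp_quotient_def divide_simps)
  have ge_1: "1 \<le> exp_quotient v" if "v \<le> 0" for v
    using that exp_ge_add_one_self[of "-v"] by (auto simp: exp_quotient_def divide_simps)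
  show "exp_quotient C \<le> exp_quotient u"
  proof (cases "u > 0")
    case True
    thus ?thesis using exp_chord[of "u / C" C] assms
      by (simp add: exp_quotient_def field_simps)
  qed (use ge_1[of u] le_1[of C] assms in auto)
  show "exp_quotient u \<le> exp_quotient c"
  proof (cases "u < 0")
    case True
    have "u / c * (1 - exp (- c)) \<le> 1 - exp (- u)"
      using exp_chord[of "u / c" c] assms True by (simp add: field_simps)
    thus ?thesis using True assms by (simp add: exp_quotient_def field_simps)
  qed (use ge_1[of c] le_1[of u] assms in auto)
qed

section \<open>The hypothesis in terms of the ratio of gain to decay\<close>

lemma contraction_criterion:
  fixes k \<tau> :: real
  assumes k: "k > 0" and less: "ln ((k\<^sup>2 + k) / (k\<^sup>2 + 1)) < exp (- \<tau>) / k"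
  shows "k * ((1 + k) * exp (- exp (- \<tau>) / k) - k) < 1"
proof -
  have pos: "k\<^sup>2 + k > 0" "k\<^sup>2 + 1 > 0" using k by (auto simp: add_pos_pos)
  have "(k\<^sup>2 + k) / (k\<^sup>2 + 1) < exp (exp (- \<tau>) / k)"
    using less pos by (metis exp_less_cancel_iff exp_ln divide_pos_pos)
  hence "(k\<^sup>2 + k) * exp (- (exp (- \<tau>) / k)) < k\<^sup>2 + 1"
    using pos by (simp add: exp_minus field_simps)
  thus ?thesis by (simp add: power2_eq_square algebra_simps)
qed

text \<open>For the delay with \<open>s\<^sub>1 = 0\<close> the criterion holds for every gain; this permits enlarging
  a smaller delay to it.\<close>

lemma contraction_criterion_large_delay:
  fixes k :: real
  assumes k: "k > 0"
  shows "ln ((k\<^sup>2 + k) / (k\<^sup>2 + 1)) < exp (- ln ((1 + k) / k)) / k"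
proof -
  have pos: "k\<^sup>2 + k > 0" "k\<^sup>2 + 1 > 0" using k by (auto simp: add_pos_pos)
  have "ln ((k\<^sup>2 + k) / (k\<^sup>2 + 1)) \<le> (k\<^sup>2 + k) / (k\<^sup>2 + 1) - 1"
    using pos by (intro ln_le_minus_one) auto
  also have "\<dots> = (k - 1) / (k\<^sup>2 + 1)" using pos by (simp add: field_simps)
  \<comment> \<open>Clearing denominators leaves
    \<open>k\<^sup>2 - 1 < k\<^sup>2 + 1\<close>.\<close>
  also have "\<dots> < 1 / (1 + k)"
    using k pos by (simp add: divide_simps power2_eq_square algebra_simps)
  also have "\<dots> = exp (- ln ((1 + k) / k)) / k"
    using k by (simp add: exp_minus)
  finally show ?thesis .
qed

section \<open>Positivity and eventual bounds of solutions\<close>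

locale mackey_glass =
  fixes r h x :: "real \<Rightarrow> real" and \<alpha> \<beta> n h\<^sub>0 r\<^sub>0 R :: real
  assumes params: "\<alpha> > 0" "\<beta> > 0" "n > 0" "r\<^sub>0 > 0"
    and r_meas: "r \<in> borel_measurable (lebesgue_on {0..})"
    and r_bounds: "\<And>t. 0 \<le> t \<Longrightarrow> r\<^sub>0 \<le> r t \<and> r t < R"
    and h_bounds: "\<And>t. 0 \<le> t \<Longrightarrow> h t \<le> t \<and> t - h t \<le> h\<^sub>0"
    and ac_x: "\<And>S. 0 \<le> S \<Longrightarrow> absolutely_continuous_fun_on {0..S} x"
    and ode: "AE t in lebesgue. 0 \<le> t \<longrightarrow>
        (x has_real_derivative r t * (\<alpha> - \<beta> * x t * hill n (x (h t)))) (at t)"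
    and history: "\<And>t. t \<le> 0 \<Longrightarrow> 0 \<le> x t" "0 < x 0"
begin

lemma R_pos: "R > 0"
  using r_bounds[of 0] params by auto

lemma cont_x: "0 \<le> s \<Longrightarrow> s \<le> t \<Longrightarrow> continuous_on {s..t} x"
  by (rule absolutely_continuous_fun_on_imp_continuous_on,
      rule absolutely_continuous_fun_on_subset[OF ac_x, of t]) auto

lemma h_top: "filterlim h at_top at_top"
proof (rule filterlim_at_top_mono)
  show "filterlim (\<lambda>t. t - h\<^sub>0) at_top at_top"
    using filterlim_tendsto_add_at_top[OF tendsto_const[of "- h\<^sub>0"] filterlim_ident] by simp
  show "eventually (\<lambda>t. t - h\<^sub>0 \<le> h t) at_top"
    using eventually_ge_at_top[of 0] by eventually_elim (use h_bounds in fastforce)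
qed

text \<open>An integral of \<open>r\<close>. It is the time scale for estimates on \<open>x\<close>
  itself, available before the rate \<open>a\<close> and its integral \<sigma>, which presuppose
  bounds on \<open>x\<close>.\<close>

definition \<rho> :: "real \<Rightarrow> real" where
  "\<rho> = (SOME \<rho>. (AE t in lebesgue. 0 < t \<longrightarrow> (\<rho> has_real_derivative r t) (at t)) \<and>
      (\<forall>s t. 0 \<le> s \<longrightarrow> s \<le> t \<longrightarrow> r\<^sub>0 * (t - s) \<le> \<rho> t - \<rho> s) \<and>
      (\<forall>S. absolutely_continuous_fun_on {0..S} \<rho>))"

lemma \<rho>:
  shows deriv_\<rho>: "AE t in lebesgue. 0 < t \<longrightarrow> (\<rho> has_real_derivative r t) (at t)"
    and \<rho>_growth: "\<And>s t. 0 \<le> s \<Longrightarrow> s \<le> t \<Longrightarrow> r\<^sub>0 * (t - s) \<le> \<rho> t - \<rho> s"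
    and ac_\<rho>: "\<And>S. absolutely_continuous_fun_on {0..S} \<rho>"
proof -
  have "\<exists>\<rho>. (AE t in lebesgue. 0 < t \<longrightarrow> (\<rho> has_real_derivative r t) (at t)) \<and>
      (\<forall>s t. 0 \<le> s \<longrightarrow> s \<le> t \<longrightarrow> r\<^sub>0 * (t - s) \<le> \<rho> t - \<rho> s) \<and>
      (\<forall>S. absolutely_continuous_fun_on {0..S} \<rho>)"
    by (rule bounded_measurable_has_antiderivative[OF r_meas, of r\<^sub>0 R])
      (use r_bounds in \<open>auto intro: less_imp_le\<close>)
  from someI_ex[OF this, folded \<rho>_def]
  show "AE t in lebesgue. 0 < t \<longrightarrow> (\<rho> has_real_derivative r t) (at t)"
    and "\<And>s t. 0 \<le> s \<Longrightarrow> s \<le> t \<Longrightarrow> r\<^sub>0 * (t - s) \<le> \<rho> t - \<rho> s"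
    and "\<And>S. absolutely_continuous_fun_on {0..S} \<rho>" by blast+
qed

lemma \<rho>_top: "filterlim \<rho> at_top at_top"
proof (rule filterlim_at_top_mono)
  show "filterlim (\<lambda>t. \<rho> 0 + r\<^sub>0 * t) at_top at_top"
    using params by (intro filterlim_tendsto_add_at_top[OF tendsto_const]
        filterlim_tendsto_pos_mult_at_top[OF tendsto_const] filterlim_ident)
  show "eventually (\<lambda>t. \<rho> 0 + r\<^sub>0 * t \<le> \<rho> t) at_top"
    using eventually_ge_at_top[of 0] by eventually_elim (use \<rho>_growth[of 0] in fastforce)
qed

text \<open>The weight contributes \<open>\<gamma> * (x u - L)\<close>, so the expression in the
  hypothesis is the derivative up to the positive factor
  \<open>r u * exp (\<gamma> * \<rho> u)\<close>. The choices 1 and -1 of \<epsilon> serve lower and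
  upper bounds.\<close>

lemma weighted_mono:
  fixes \<gamma> L \<epsilon> :: real
  assumes st: "0 \<le> s" "s \<le> t"
    and le: "\<And>u. s < u \<Longrightarrow> u < t \<Longrightarrow> 0 \<le> \<epsilon> * (\<gamma> * (x u - L) + \<alpha> - \<beta> * x u * hill n (x (h u)))"
  shows "exp (\<gamma> * \<rho> s) * (\<epsilon> * (x s - L)) \<le> exp (\<gamma> * \<rho> t) * (\<epsilon> * (x t - L))"
proof -
  define f where "f = (\<lambda>u. exp (\<gamma> * \<rho> u) * (- \<epsilon> * (x u - L)))"
  have ac: "absolutely_continuous_fun_on {s..t} x" "absolutely_continuous_fun_on {s..t} \<rho>"
    using st by (auto intro: absolutely_continuous_fun_on_subset[OF ac_x, of t]
        absolutely_continuous_fun_on_subset[OF ac_\<rho>, of _ t])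
  have "f t \<le> f s"
  proof (rule absolutely_continuous_fun_on_nonincreasing[OF _ st(2)])
    show "absolutely_continuous_fun_on {s..t} f"
      unfolding f_def
    proof (rule absolutely_continuous_fun_on_mult)
      show "absolutely_continuous_fun_on {s..t} (\<lambda>u. exp (\<gamma> * \<rho> u))"
        by (rule absolutely_continuous_fun_on_compose[OF ac(2), where G = "\<lambda>z. exp (\<gamma> * z)" and G' = "\<lambda>z. \<gamma> * exp (\<gamma> * z)"])
          (auto intro!: derivative_eq_intros continuous_intros)
      show "absolutely_continuous_fun_on {s..t} (\<lambda>u. - \<epsilon> * (x u - L))"
        by (rule absolutely_continuous_fun_on_compose[OF ac(1), where G = "\<lambda>z. - \<epsilon> * (z - L)" and G' = "\<lambda>_. - \<epsilon>"])
          (auto intro!: derivative_eq_intros continuous_intros)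
    qed
    show "AE u in lebesgue. s < u \<and> u < t \<longrightarrow> (\<exists>D\<le>0. (f has_real_derivative D) (at u))"
      using ode deriv_\<rho>
    proof eventually_elim
      case (elim u)
      show ?case
      proof
        assume u: "s < u \<and> u < t"
        hence d: "(x has_real_derivative r u * (\<alpha> - \<beta> * x u * hill n (x (h u)))) (at u)"
          "(\<rho> has_real_derivative r u) (at u)" using elim st by auto
        define E where "E = \<epsilon> * (\<gamma> * (x u - L) + \<alpha> - \<beta> * x u * hill n (x (h u)))"
        have "0 \<le> E" using le u by (simp add: E_def)
        moreover have "0 \<le> r u" using r_bounds[of u] params u st by auto
        ultimately have "- (exp (\<gamma> * \<rho> u) * r u * E) \<le> 0" by simp
        moreover have "(f has_real_derivative - (exp (\<gamma> * \<rho> u) * r u * E)) (at u)"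
          unfolding f_def E_def by (rule derivative_eq_intros d refl)+ (simp add: algebra_simps)
        ultimately show "\<exists>D\<le>0. (f has_real_derivative D) (at u)" by blast
      qed
    qed
  qed
  thus ?thesis by (simp add: f_def)
qed

text \<open>Up to the first nonpositive time the loss is at most \<open>\<beta> * x\<close>,
  whatever the delayed value, because the Hill function is below 1; hence
  \<open>exp (\<beta> * \<rho>) * x\<close> cannot decrease.\<close>

lemma x_pos: 
  assumes "0 \<le> t"
  shows "0 < x t"
proof (rule ccontr)
  assume "\<not> 0 < x t"
  define S where "S = {s \<in> {0..t}. x s \<in> {..0}}"
  have "closed S"
    unfolding S_def using continuous_closed_preimage[OF cont_x[of 0 t], of "{..0}"] assms
    by (simp add: vimage_def Int_def)
  moreover have "bounded S" by (rule bounded_subset[of "{0..t}"]) (auto simp: S_def)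
  moreover have "t \<in> S" using assms \<open>\<not> 0 < x t\<close> by (auto simp: S_def)
  ultimately obtain t0 where t0: "t0 \<in> S" "\<And>s. s \<in> S \<Longrightarrow> t0 \<le> s"
    using compact_attains_inf[of S] by (auto simp: compact_eq_bounded_closed)
  have t0': "0 \<le> t0" "t0 \<le> t" "x t0 \<le> 0" using t0(1) by (auto simp: S_def)
  have before_t0: "0 < x u" if "0 < u" "u < t0" for u
    using t0(2)[of u] that t0' unfolding S_def by force
  have "exp (\<beta> * \<rho> 0) * (1 * (x 0 - 0)) \<le> exp (\<beta> * \<rho> t0) * (1 * (x t0 - 0))"
  proof (rule weighted_mono)
    fix u assume u: "0 < u" "u < t0"
    have "0 \<le> \<beta> * x u * (1 - hill n (x (h u)))"
      using before_t0[OF u] params hill_less_one[of n "x (h u)"] by (intro mult_nonneg_nonneg) auto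
    hence "0 \<le> \<beta> * x u * (1 - hill n (x (h u))) + \<alpha>" using params by linarith
    also have "\<dots> = 1 * (\<beta> * (x u - 0) + \<alpha> - \<beta> * x u * hill n (x (h u)))"
      by (simp add: algebra_simps)
    finally show "0 \<le> 1 * (\<beta> * (x u - 0) + \<alpha> - \<beta> * x u * hill n (x (h u)))" .
  qed (use t0' in auto)
  moreover have "exp (\<beta> * \<rho> t0) * x t0 \<le> 0" using t0' by (simp add: mult_le_0_iff)
  moreover have "0 < exp (\<beta> * \<rho> 0) * x 0" using history by simp
  ultimately show False by simp
qed

lemma x_nonneg: "0 \<le> x t"
  using x_pos[of t] history(1)[of t] by (cases "t \<le> 0") auto

text \<open>For \<epsilon> = 1 the Hill term is eventually at most \<open>G\<close>, and
  \<open>x\<close> is compared with the linear equation of rate \<open>\<beta> * G\<close>, whose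
  equilibrium is \<open>\<alpha> / \<beta> / G\<close>; for \<epsilon> = -1 everything is reversed.
  The weighted deviation stays above \<open>D\<close> while the weight tends to infinity.\<close>

lemma asymptotic_bound:
  assumes G: "0 < G" "eventually (\<lambda>t. 0 \<le> \<epsilon> * (G - hill n (x (h t)))) at_top" and e: "0 < e"
  shows "eventually (\<lambda>t. - e \<le> \<epsilon> * (x t - \<alpha> / \<beta> / G)) at_top"
proof -
  define L where "L = \<alpha> / \<beta> / G"
  have L: "\<beta> * G * L = \<alpha>" using params G by (simp add: L_def)
  obtain s where s: "0 \<le> s" "\<And>t. s \<le> t \<Longrightarrow> 0 \<le> \<epsilon> * (G - hill n (x (h t)))"
    using eventually_conj[OF G(2) eventually_ge_at_top[of 0]]
    unfolding eventually_at_top_linorder by auto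
  define D where "D = exp (\<beta> * G * \<rho> s) * (\<epsilon> * (x s - L))"
  have D: "D \<le> exp (\<beta> * G * \<rho> t) * (\<epsilon> * (x t - L))" if "s \<le> t" for t
    unfolding D_def
  proof (rule weighted_mono[OF s(1) that])
    fix u assume "s < u"
    hence "0 \<le> \<beta> * x u * (\<epsilon> * (G - hill n (x (h u))))"
      using s(2)[of u] x_nonneg[of u] params
      by (intro mult_nonneg_nonneg[OF mult_nonneg_nonneg]) auto
    also have "\<dots> = \<epsilon> * (\<beta> * G * (x u - L) + \<beta> * G * L - \<beta> * x u * hill n (x (h u)))"
      by (simp add: algebra_simps)
    finally show "0 \<le> \<epsilon> * (\<beta> * G * (x u - L) + \<alpha> - \<beta> * x u * hill n (x (h u)))"
      unfolding L .
  qed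
  have "filterlim (\<lambda>t. exp (\<beta> * G * \<rho> t)) at_top at_top"
    using params G by (intro filterlim_compose[OF exp_at_top]
        filterlim_tendsto_pos_mult_at_top[OF tendsto_const] \<rho>_top) auto
  hence "eventually (\<lambda>t. \<bar>D\<bar> / e \<le> exp (\<beta> * G * \<rho> t) \<and> s \<le> t) at_top"
    unfolding filterlim_at_top by (intro eventually_conj eventually_ge_at_top) blast
  thus ?thesis
  proof eventually_elim
    case (elim t)
    have "exp (\<beta> * G * \<rho> t) * - e \<le> - \<bar>D\<bar>" using elim e by (simp add: field_simps)
    also have "\<dots> \<le> D" by simp
    also have "\<dots> \<le> exp (\<beta> * G * \<rho> t) * (\<epsilon> * (x t - L))" using D elim by blast
    finally show ?case by (simp only: mult_le_cancel_left_pos exp_gt_zero L_def)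
  qed
qed

text \<open>A bootstrap: a bound on \<open>x\<close> bounds the Hill term and thereby
  \<open>x\<close> again. Each round loses a small amount, so the sharp endpoints need room to
  spare: a crude upper bound keeps the Hill term below some \<open>G < 1\<close>, which forces
  \<open>x\<close> above some \<open>L > \<mu>\<close>, and this leaves room below
  \<open>\<mu> / hill n \<mu>\<close>.\<close>

lemma eventually_bounds:
  defines "\<mu> \<equiv> \<alpha> / \<beta>"
  shows "eventually (\<lambda>t. \<mu> \<le> x t \<and> x t \<le> \<mu> / hill n \<mu>) at_top"
proof -
  have \<mu>: "0 < \<mu>" using params by (simp add: \<mu>_def)
  have delayed: "eventually (\<lambda>t. P (x (h t))) at_top" if "eventually (\<lambda>t. P (x t)) at_top" for P
    using eventually_compose_filterlim[OF that h_top] .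
  have lower: "eventually (\<lambda>t. L \<le> x t) at_top"
    if "0 < G" "eventually (\<lambda>t. hill n (x (h t)) \<le> G) at_top" "L < \<mu> / G" for G L
  proof -
    have "eventually (\<lambda>t. - (\<mu> / G - L) \<le> 1 * (x t - \<alpha> / \<beta> / G)) at_top"
      using that by (intro asymptotic_bound) auto
    thus ?thesis by eventually_elim (simp add: \<mu>_def)
  qed
  have upper: "eventually (\<lambda>t. x t \<le> L) at_top"
    if "0 < G" "eventually (\<lambda>t. G \<le> hill n (x (h t))) at_top" "\<mu> / G < L" for G L
  proof -
    have "eventually (\<lambda>t. - (L - \<mu> / G) \<le> - 1 * (x t - \<alpha> / \<beta> / G)) at_top"
      using that by (intro asymptotic_bound) auto
    thus ?thesis by eventually_elim (simp add: \<mu>_def)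
  qed
  have "eventually (\<lambda>t. \<mu> / 2 \<le> x t) at_top"
    using \<mu> less_imp_le[OF hill_less_one] by (intro lower[of 1] always_eventually allI) auto
  hence "eventually (\<lambda>t. hill n (\<mu> / 2) \<le> hill n (x (h t))) at_top"
    using \<mu> params by (intro delayed) (auto intro: hill_mono elim!: eventually_mono)
  hence "eventually (\<lambda>t. x t \<le> \<mu> / hill n (\<mu> / 2) + 1) at_top"
    using \<mu> by (intro upper[of "hill n (\<mu> / 2)"] hill_pos) auto
  then obtain B where B: "0 < B" "eventually (\<lambda>t. x t \<le> B) at_top"
    using \<mu> hill_nonneg[of n "\<mu> / 2"] by (metis add_nonneg_pos divide_nonneg_nonneg less_imp_le zero_less_one)
  define G where "G = hill n B"
  have G: "0 < G" "G < 1" using B hill_pos hill_less_one by (auto simp: G_def)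
  obtain L where L: "\<mu> < L" "L < \<mu> / G"
    using dense[of \<mu> "\<mu> / G"] \<mu> G by (auto simp: field_simps)
  have "eventually (\<lambda>t. hill n (x (h t)) \<le> G) at_top"
    unfolding G_def using B params x_nonneg by (intro delayed) (auto intro: hill_mono elim!: eventually_mono)
  hence low: "eventually (\<lambda>t. L \<le> x t) at_top"
    using L G by (intro lower)
  hence "eventually (\<lambda>t. hill n L \<le> hill n (x (h t))) at_top"
    using \<mu> L params by (intro delayed) (auto intro: hill_mono elim!: eventually_mono)
  moreover have "\<mu> / hill n L < \<mu> / hill n \<mu>"
    using \<mu> L params hill_less[of n \<mu> L] hill_pos[of \<mu> n] by (intro divide_strict_left_mono) auto
  ultimately have "eventually (\<lambda>t. x t \<le> \<mu> / hill n \<mu>) at_top"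
    using \<mu> L hill_pos[of L n] by (intro upper) auto
  with low show ?thesis by eventually_elim (use L in auto)
qed

end

text \<open>The equilibrium equation reads \<open>K * hill n K = \<alpha> / \<beta>\<close>; the
  order relations follow since the Hill function is below 1 and increasing.\<close>

lemma hill_equilibrium:
  assumes "\<alpha> > 0" "\<beta> > 0" "n > 0" and K: "K = mackey_glass_equilibrium \<alpha> \<beta> n"
  shows "0 < K" "\<beta> * hill n K = \<alpha> / K" "\<alpha> / \<beta> < K" "K < \<alpha> / \<beta> / hill n (\<alpha> / \<beta>)"
proof -
  have "K > 0 \<and> \<beta> * K powr (n + 1) = \<alpha> * (1 + K powr n)"
    unfolding K mackey_glass_equilibrium_def
    by (rule theI'[OF mackey_glass_equilibrium_ex1[OF assms(1-3)]])
  hence K0: "K > 0" and eq: "\<beta> * (K powr n * K) = \<alpha> * (1 + K powr n)"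
    by (auto simp: powr_add)
  show "0 < K" by fact
  have "0 < 1 + K powr n" by (rule add_pos_nonneg) simp_all
  thus hill_K: "\<beta> * hill n K = \<alpha> / K"
    using eq K0 by (simp add: hill_def field_simps)
  hence "K * hill n K = \<alpha> / \<beta>" using K0 assms by (simp add: field_simps)
  moreover have "K * hill n K < K * 1" using K0 hill_less_one by (intro mult_strict_left_mono)
  ultimately show less: "\<alpha> / \<beta> < K" by simp
  have "K = \<alpha> / \<beta> / hill n K"
    unfolding \<open>K * hill n K = \<alpha> / \<beta>\<close>[symmetric] using hill_pos[OF K0, of n] by simp
  also have "\<dots> < \<alpha> / \<beta> / hill n (\<alpha> / \<beta>)"
    using assms less K0 hill_pos[of "\<alpha> / \<beta>" n] hill_pos[OF K0, of n] hill_less[of n "\<alpha> / \<beta>" K]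
    by (intro divide_strict_left_mono) auto
  finally show "K < \<alpha> / \<beta> / hill n (\<alpha> / \<beta>)" .
qed

section \<open>Reduction of the theorem to delayed feedback\<close>

theorem theorem7:
  fixes r h :: "real \<Rightarrow> real"
    and \<alpha> \<beta> n K \<mu> M c C h\<^sub>0 r\<^sub>0 R a\<^sub>0 A b\<^sub>0 :: real
  assumes "\<alpha> > 0" and "\<beta> > 0" and "n > 0"
    and "r \<in> borel_measurable (lebesgue_on {0..})"
    and "h \<in> borel_measurable (lebesgue_on {0..})"
    and "\<forall>t\<ge>0. h t \<le> t"
    and "K = mackey_glass_equilibrium \<alpha> \<beta> n"
    and "\<mu> = \<alpha> / \<beta>"
    and "M = \<alpha> / \<beta> * (1 + (\<beta> / \<alpha>) powr n)"
    and "c = ln (\<mu> / K)"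
    and "C = ln (M / K)"
    and "\<forall>t\<ge>0. t - h t \<le> h\<^sub>0"
    and "r\<^sub>0 > 0"
    and "\<forall>t\<ge>0. r\<^sub>0 \<le> r t \<and> r t < R"
    and "a\<^sub>0 = \<alpha> / K * ((1 - exp (- C)) / C) * r\<^sub>0"
    and "A = \<alpha> / K * ((1 - exp (- c)) / c) * R"
    and "b\<^sub>0 = \<beta> * n * R / 4"
    and "a\<^sub>0 / b\<^sub>0 * exp (- A * h\<^sub>0) > ln ((b\<^sub>0\<^sup>2 + a\<^sub>0 * b\<^sub>0) / (b\<^sub>0\<^sup>2 + a\<^sub>0\<^sup>2))"
  shows "\<forall>\<phi> x. admissible_initial_function \<phi> \<and> (\<forall>t\<le>0. \<phi> t \<ge> 0) \<and> \<phi> 0 > 0 \<and>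
           mackey_glass_solution r h \<alpha> \<beta> n \<phi> x
           \<longrightarrow> (x \<longlongrightarrow> K) at_top"
proof (intro allI impI)
  fix \<phi> x
  assume sol: "admissible_initial_function \<phi> \<and> (\<forall>t\<le>0. \<phi> t \<ge> 0) \<and> \<phi> 0 > 0 \<and>
           mackey_glass_solution r h \<alpha> \<beta> n \<phi> x"
  interpret mackey_glass r h x \<alpha> \<beta> n h\<^sub>0 r\<^sub>0 R
    using assms sol by unfold_locales
      (auto simp: mackey_glass_solution_def hill_def simp flip: times_divide_eq_right)
  note K = hill_equilibrium[OF assms(1-3,7)]
  have \<mu>: "0 < \<mu>" "\<mu> < K" using assms(1,2,8) K(3) by auto
  have M: "M = \<mu> / hill n \<mu>"
  proof -
    have "(\<beta> / \<alpha>) powr n = 1 / \<mu> powr n"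
      using assms(1,2,8) powr_divide[of \<alpha> \<beta> n] powr_divide[of \<beta> \<alpha> n] by simp
    hence "M = \<mu> * (1 + 1 / \<mu> powr n)" using assms(8,9) by simp
    moreover have "0 < \<mu> powr n" using \<mu> by simp
    ultimately show ?thesis by (simp add: hill_def field_simps)
  qed
  have "K < M" using K(4) M assms(8) by simp
  \<comment> \<open>Strictness makes the denominators in \<open>a\<^sub>0\<close> and
    \<open>A\<close> nonzero, so these quotients agree with \<open>exp_quotient\<close>.\<close>
  have c: "c < 0" "0 < C"
    using \<mu> \<open>K < M\<close> K(1) assms(10,11) by (auto simp: ln_less_zero_iff)
  have a\<^sub>0: "a\<^sub>0 = r\<^sub>0 * (\<alpha> / K * exp_quotient C)" and A: "A = R * (\<alpha> / K * exp_quotient c)"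
    using c assms(15,16) by (auto simp: exp_quotient_def)
  have a\<^sub>0_pos: "0 < a\<^sub>0" using assms(1,13) K(1) exp_quotient_pos unfolding a\<^sub>0 by simp
  have b\<^sub>0_pos: "0 < b\<^sub>0" using assms(2,3) R_pos unfolding assms(17) by simp
  define k where "k = b\<^sub>0 / a\<^sub>0"
  have k: "k > 0" using a\<^sub>0_pos b\<^sub>0_pos by (simp add: k_def)
  define \<tau> where "\<tau> = max (A * h\<^sub>0) (ln ((1 + k) / k))"
  define s\<^sub>1 where "s\<^sub>1 = \<tau> - ln ((1 + k) / k)"
  have s\<^sub>1: "0 \<le> s\<^sub>1" "(1 + k) * exp s\<^sub>1 = k * exp \<tau>"
    using k by (auto simp: s\<^sub>1_def \<tau>_def exp_diff)
  have contr: "k * ((1 + k) * exp (- exp (- \<tau>) / k) - k) < 1"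
  proof (rule contraction_criterion[OF k])
    have "(b\<^sub>0\<^sup>2 + a\<^sub>0 * b\<^sub>0) / (b\<^sub>0\<^sup>2 + a\<^sub>0\<^sup>2) = (k\<^sup>2 + k) / (k\<^sup>2 + 1)"
    proof -
      have "b\<^sub>0 = k * a\<^sub>0" using a\<^sub>0_pos by (simp add: k_def)
      hence "(b\<^sub>0\<^sup>2 + a\<^sub>0 * b\<^sub>0) / (b\<^sub>0\<^sup>2 + a\<^sub>0\<^sup>2) = (a\<^sub>0\<^sup>2 * (k\<^sup>2 + k)) / (a\<^sub>0\<^sup>2 * (k\<^sup>2 + 1))"
        by (simp add: power2_eq_square algebra_simps)
      thus ?thesis using a\<^sub>0_pos by simp
    qed
    hence "ln ((k\<^sup>2 + k) / (k\<^sup>2 + 1)) < exp (- (A * h\<^sub>0)) / k"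
      using assms(18) by (simp add: k_def mult.commute)
    thus "ln ((k\<^sup>2 + k) / (k\<^sup>2 + 1)) < exp (- \<tau>) / k"
      using contraction_criterion_large_delay[OF k] by (auto simp: \<tau>_def max_def)
  qed
  \<comment> \<open>The condition on \<open>h\<close> avoids negative times, at which the history
    may vanish and \<open>y\<close> would not represent \<open>x\<close>.\<close>
  obtain T0 where T0: "0 \<le> T0" "\<And>t. T0 \<le> t \<Longrightarrow> \<mu> \<le> x t \<and> x t \<le> M \<and> 0 \<le> h t"
  proof -
    have "eventually (\<lambda>t. 0 \<le> h t) at_top" using h_top by (simp add: filterlim_at_top)
    hence "eventually (\<lambda>t. 0 \<le> t \<and> (\<mu> \<le> x t \<and> x t \<le> M \<and> 0 \<le> h t)) at_top"
      using eventually_ge_at_top[of 0] eventually_bounds unfolding M assms(8)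
      by eventually_elim auto
    then obtain N where "\<And>t. N \<le> t \<Longrightarrow> 0 \<le> t \<and> (\<mu> \<le> x t \<and> x t \<le> M \<and> 0 \<le> h t)"
      unfolding eventually_at_top_linorder by blast
    thus thesis by (intro that[of N]) auto
  qed
  define y where "y = (\<lambda>t. ln (x t / K))"
  have xy: "x t = K * exp (y t)" if "0 \<le> t" for t
    using x_pos[OF that] K(1) by (simp add: y_def)
  have y_bounds: "c \<le> y t \<and> y t \<le> C" if "T0 \<le> t" for t
    using T0(2)[OF that] \<mu> K(1) unfolding y_def assms(10,11)
    by (auto intro!: ln_mono divide_right_mono)
  \<comment> \<open>From
    \<open>\<alpha> / x - \<alpha> / K = \<alpha> / K * (exp (- y) - 1)\<close>, where the last
    factor is \<open>- exp_quotient y * y\<close>.\<close>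
  define a where "a = (\<lambda>t. r t * (\<alpha> / K * exp_quotient (y t)))"
  have a_bounds: "a\<^sub>0 \<le> a t \<and> a t \<le> A" if "T0 \<le> t" for t
  proof -
    have r: "r\<^sub>0 \<le> r t" "r t < R" using r_bounds[of t] T0(1) that by auto
    have q: "exp_quotient C \<le> exp_quotient (y t)" "exp_quotient (y t) \<le> exp_quotient c"
      using exp_quotient_antimono[OF c, of "y t"] y_bounds[OF that] by auto
    thus ?thesis unfolding a_def a\<^sub>0 A
      using r assms(1,13) K(1) R_pos exp_quotient_pos[of C] exp_quotient_pos[of "y t"]
      by (intro conjI mult_mono) (auto simp: less_imp_le)
  qed
  have cont_y: "continuous_on {T0..} y"
  proof -
    have "continuous_on {T0..} x"
      unfolding continuous_on_eq_continuous_within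
    proof
      fix t assume "t \<in> {T0..}"
      hence "continuous (at t within {T0..t + 1}) x"
        using cont_x[of T0 "t + 1"] T0(1) by (simp add: continuous_on_eq_continuous_within)
      moreover have "at t within {T0..t + 1} = at t within {T0..}"
        using \<open>t \<in> {T0..}\<close> by (intro at_within_nhd[of _ "{..<t + 1}"]) auto
      ultimately show "continuous (at t within {T0..}) x" by simp
    qed
    moreover have "x t / K \<noteq> 0" if "t \<in> {T0..}" for t
      using x_pos[of t] K(1) T0(1) that by auto
    ultimately show ?thesis
      unfolding y_def using K(1) by (intro continuous_intros ballI) auto
  qed
  have a_meas: "a \<in> borel_measurable (lebesgue_on {T0..})"
  proof -
    have "y \<in> borel_measurable (lebesgue_on {T0..})"
      by (intro continuous_imp_measurable_on_sets_lebesgue cont_y) auto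
    from measurable_compose[OF this exp_quotient_measurable]
    have "(\<lambda>t. exp_quotient (y t)) \<in> borel_measurable (lebesgue_on {T0..})" .
    moreover have "r \<in> borel_measurable (lebesgue_on {T0..})"
      by (rule measurable_restrict_mono[OF r_meas]) (use T0 in auto)
    ultimately show ?thesis unfolding a_def by measurable
  qed
  obtain \<sigma> where \<sigma>: "AE t in lebesgue. T0 < t \<longrightarrow> (\<sigma> has_real_derivative a t) (at t)"
    "\<And>s t. T0 \<le> s \<Longrightarrow> s \<le> t \<Longrightarrow> a\<^sub>0 * (t - s) \<le> \<sigma> t - \<sigma> s \<and> \<sigma> t - \<sigma> s \<le> A * (t - s)"
    "\<And>S. absolutely_continuous_fun_on {T0..S} \<sigma>"
    by (rule bounded_measurable_has_antiderivative[OF a_meas a_bounds], assumption) (erule that; simp)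
  have "\<exists>\<theta>. 0 \<le> \<theta> \<and> \<theta> \<le> n / 4 \<and> hill n (x (h t)) - hill n K = \<theta> * y (h t)" if "T0 \<le> t" for t
  proof -
    have "x (h t) = K * exp (y (h t))" using T0(2)[OF that] by (intro xy) auto
    thus ?thesis using hill_exp_slope[OF assms(3) K(1), of "y (h t)"] by metis
  qed
  \<comment> \<open>Here \<theta> is the chord slope of the logistic curve, not the contraction
    constant; a pointwise choice suffices because only its bounds and the identity are used.\<close>
  then obtain \<theta> where \<theta>: "\<And>t. T0 \<le> t \<Longrightarrow> 0 \<le> \<theta> t \<and> \<theta> t \<le> n / 4 \<and>
      hill n (x (h t)) - hill n K = \<theta> t * y (h t)" by metis
  \<comment> \<open>Dividing by \<open>a\<close> normalises the decay to rate one in \<sigma>-time;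
    the numerator is at most \<open>b\<^sub>0\<close> and the denominator at least
    \<open>a\<^sub>0\<close>, whence \<open>k\<close>.\<close>
  define \<kappa> where "\<kappa> = (\<lambda>t. r t * \<beta> * \<theta> t / a t)"
  interpret delayed_feedback y \<sigma> a \<kappa> h T0 k \<tau> s\<^sub>1
  proof
    show "absolutely_continuous_fun_on {T0..S} y" for S
      unfolding y_def
    proof (rule absolutely_continuous_fun_on_compose[where f = x and G = "\<lambda>z. ln (z / K)" and G' = "\<lambda>z. 1 / z"])
      have "absolutely_continuous_fun_on {0..max 0 S} x" by (rule ac_x) simp
      thus "absolutely_continuous_fun_on {T0..S} x"
        by (rule absolutely_continuous_fun_on_subset) (use T0(1) in auto)
      have pos: "0 < z" if "z \<in> x ` {T0..S}" for z using that x_pos T0(1) by auto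
      show "((\<lambda>z. ln (z / K)) has_real_derivative 1 / z) (at z)" if "z \<in> x ` {T0..S}" for z
        using pos[OF that] K(1) by (auto intro!: derivative_eq_intros simp: field_simps)
      show "continuous_on (x ` {T0..S}) (\<lambda>z. 1 / z)"
        using pos by (intro continuous_intros) force
    qed
    show "AE t in lebesgue. T0 < t \<longrightarrow> 0 < a t \<and> (\<sigma> has_real_derivative a t) (at t) \<and>
          (y has_real_derivative - a t * (y t + \<kappa> t * y (h t))) (at t)"
      using \<sigma>(1) ode
    proof eventually_elim
      case (elim t)
      show ?case
      proof
        assume t: "T0 < t"
        have a: "0 < a t" using a_bounds[of t] a\<^sub>0_pos t by auto
        have x: "0 < x t" using x_pos T0(1) t by auto
        have dx: "(x has_real_derivative r t * (\<alpha> - \<beta> * x t * hill n (x (h t)))) (at t)"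
          using elim t T0(1) by auto
        have "(y has_real_derivative (r t * (\<alpha> - \<beta> * x t * hill n (x (h t)))) / x t) (at t)"
          unfolding y_def using x K(1) dx
          by (auto intro!: derivative_eq_intros simp: field_simps)
        moreover have "(r t * (\<alpha> - \<beta> * x t * hill n (x (h t)))) / x t = - a t * (y t + \<kappa> t * y (h t))"
        proof -
          have "exp (- y t) = K / x t" using x K(1) by (simp add: y_def exp_minus)
          hence "a t * y t = r t * (\<alpha> / K * (1 - K / x t))"
            unfolding a_def by (metis exp_quotient_mult mult.assoc)
          also have "\<dots> = r t * (\<beta> * hill n K - \<alpha> / x t)"
            using K x by (simp add: field_simps)
          finally have "a t * y t = r t * (\<beta> * hill n K - \<alpha> / x t)" .
          moreover have "a t * (\<kappa> t * y (h t)) = r t * \<beta> * (hill n (x (h t)) - hill n K)"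
            using \<theta>[of t] t a by (simp add: \<kappa>_def)
          moreover have "(r t * (\<alpha> - \<beta> * x t * hill n (x (h t)))) / x t
              = r t * (\<alpha> / x t) - r t * \<beta> * hill n (x (h t))"
            using x by (simp add: field_simps)
          ultimately show ?thesis by (simp add: algebra_simps)
        qed
        ultimately show "0 < a t \<and> (\<sigma> has_real_derivative a t) (at t) \<and>
          (y has_real_derivative - a t * (y t + \<kappa> t * y (h t))) (at t)"
          using a elim t by simp
      qed
    qed
    show "0 \<le> \<kappa> t \<and> \<kappa> t \<le> k" if t: "T0 \<le> t" for t
    proof -
      have r: "0 < r t" "r t < R" using r_bounds[of t] T0(1) t assms(13) by auto
      have a: "0 < a t" "a\<^sub>0 \<le> a t" using a_bounds[OF t] a\<^sub>0_pos by auto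
      have "r t * \<beta> * \<theta> t \<le> R * \<beta> * (n / 4)"
        using r \<theta>[OF t] assms(2) by (intro mult_mono) auto
      also have "\<dots> = b\<^sub>0" using assms(17) by simp
      finally have "\<kappa> t \<le> k"
        unfolding \<kappa>_def k_def using a a\<^sub>0_pos b\<^sub>0_pos by (intro frac_le) auto
      moreover have "0 \<le> \<kappa> t"
        unfolding \<kappa>_def using r a \<theta>[OF t] assms(2) by simp
      ultimately show ?thesis by blast
    qed
    show "\<sigma> s < \<sigma> t" if "T0 \<le> s" "s < t" for s t
      using \<sigma>(2)[of s t] that mult_pos_pos[OF a\<^sub>0_pos, of "t - s"] by auto
    show "filterlim \<sigma> at_top at_top"
    proof (rule filterlim_at_top_mono)
      show "filterlim (\<lambda>t. (\<sigma> T0 - a\<^sub>0 * T0) + a\<^sub>0 * t) at_top at_top"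
        using a\<^sub>0_pos by (intro filterlim_tendsto_add_at_top[OF tendsto_const]
            filterlim_tendsto_pos_mult_at_top[OF tendsto_const] filterlim_ident)
      show "eventually (\<lambda>t. (\<sigma> T0 - a\<^sub>0 * T0) + a\<^sub>0 * t \<le> \<sigma> t) at_top"
        using eventually_ge_at_top[of T0]
      proof eventually_elim
        case (elim t)
        show ?case using \<sigma>(2)[of T0 t] elim by (simp add: algebra_simps)
      qed
    qed
    show "h t \<le> t" if "T0 \<le> t" for t using h_bounds[of t] that T0(1) by auto
    show "filterlim h at_top at_top" by (rule h_top)
    show "\<sigma> t - \<sigma> (h t) \<le> \<tau>" if t: "T0 \<le> h t" "T0 \<le> t" for t
    proof -
      have h: "h t \<le> t" "t - h t \<le> h\<^sub>0" using h_bounds[of t] t T0(1) by auto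
      have "0 \<le> A" using a_bounds[of T0] a\<^sub>0_pos by auto
      have "\<sigma> t - \<sigma> (h t) \<le> A * (t - h t)" using \<sigma>(2)[OF t(1) h(1)] by simp
      also have "\<dots> \<le> A * h\<^sub>0" using h \<open>0 \<le> A\<close> by (intro mult_left_mono)
      finally show ?thesis by (simp add: \<tau>_def)
    qed
  qed (use \<sigma>(3) k s\<^sub>1 in auto)
  have "(y \<longlongrightarrow> 0) at_top"
  proof (rule tendsto_zero)
    show "contraction < 1" using contr by (simp add: contraction_def)
    show "eventually (\<lambda>t. \<bar>y t\<bar> \<le> max (- c) C) at_top"
      using eventually_ge_at_top[of T0]
    proof eventually_elim
      case (elim t)
      thus ?case using y_bounds[of t] by (auto simp: abs_le_iff max_def)
    qed
  qed
  hence "((\<lambda>t. K * exp (y t)) \<longlongrightarrow> K * exp 0) at_top"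
    by (intro tendsto_intros)
  moreover have "eventually (\<lambda>t. K * exp (y t) = x t) at_top"
    using eventually_ge_at_top[of 0] by eventually_elim (simp add: xy)
  ultimately show "(x \<longlongrightarrow> K) at_top"
    by (simp add: tendsto_cong)
qed

end
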